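(* For every integer $m\geq 0$ and every integer $r\geq 3$, $$\operatorname{forb}(m,r,M)\leq\left(1+\tfrac{83}{192}\right)m(r-1)^{m-1}+(r-1)^m.$$
   Context: An $r$-matrix is a matrix with entries in $\{0,1,\dots,r-1\}$; it is simple if its columns are pairwise distinct. A matrix $A$ contains a configuration of $F$ if some submatrix of $A$ is a row and column permutation of $F$. Let $M=\begin{bmatrix}0&1\\0&1\\1&0\end{bmatrix}$, and let $\operatorname{forb}(m,r,M)$ be the maximum number of columns of an $m$-rowed simple $r$-matrix containing no configuration of $M$. *)

theory Defs
  imports "Jordan_Normal_Form.DL_Submatrix"
begin

definition r_matrix :: "nat \<Rightarrow> nat mat \<Rightarrow> bool" where
  "r_matrix r A \<longleftrightarrow> elements_mat A \<subseteq> {0..<r}"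

definition simple_mat :: "'a mat \<Rightarrow> bool" where
  "simple_mat A \<longleftrightarrow> distinct (cols A)"

definition row_col_permutation :: "'a mat \<Rightarrow> 'a mat \<Rightarrow> bool" where
  "row_col_permutation B F \<longleftrightarrow>
     dim_row B = dim_row F \<and> dim_col B = dim_col F \<and>
     (\<exists>p q. p permutes {0..<dim_row F} \<and> q permutes {0..<dim_col F} \<and>
        (\<forall>i<dim_row F. \<forall>j<dim_col F. B $$ (i, j) = F $$ (p i, q j)))"

definition contains_configuration :: "'a mat \<Rightarrow> 'a mat \<Rightarrow> bool" where
  "contains_configuration A F \<longleftrightarrow> (\<exists>I J. row_col_permutation (submatrix A I J) F)"

definition avoiding_matrices :: "nat \<Rightarrow> nat \<Rightarrow> nat mat \<Rightarrow> nat mat set" where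
  "avoiding_matrices m r F =
     {A. dim_row A = m \<and> r_matrix r A \<and> simple_mat A \<and> \<not> contains_configuration A F}"

definition forb :: "nat \<Rightarrow> nat \<Rightarrow> nat mat \<Rightarrow> nat" where
  "forb m r F = Max (dim_col ` avoiding_matrices m r F)"

text \<open>The maximum is taken over a finite set, which is nonempty as soon as \<open>F\<close> has a column
  (the matrix without columns then avoids \<open>F\<close>).\<close>

lemma finite_dim_col_avoiding: "finite (dim_col ` avoiding_matrices m r F)"
proof -
  let ?V = "vec_of_list ` {xs. set xs \<subseteq> {0..<r} \<and> length xs = m}"
  have fin: "finite ?V" by (intro finite_imageI finite_lists_length_eq) simp
  have "dim_col A \<le> card ?V" if A: "A \<in> avoiding_matrices m r F" for A
  proof -
    have "col A j \<in> ?V" if j: "j < dim_col A" for j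
    proof -
      have "A $$ (i, j) \<in> elements_mat A" if "i < dim_row A" for i
        by (rule elements_matI[of A "dim_row A" "dim_col A" i j]) (use that j in auto)
      then have "set (list_of_vec (col A j)) \<subseteq> {0..<r}"
        using A j unfolding avoiding_matrices_def r_matrix_def
        by (fastforce simp: set_list_of_vec vec_set_def)
      moreover have "length (list_of_vec (col A j)) = m"
        using A by (simp add: avoiding_matrices_def)
      ultimately show ?thesis
        by (intro image_eqI[of _ _ "list_of_vec (col A j)"]) (simp_all add: vec_list)
    qed
    then have "set (cols A) \<subseteq> ?V" by (auto simp: cols_def)
    then have "card (set (cols A)) \<le> card ?V" by (rule card_mono[OF fin])
    then show ?thesis
      using A by (simp add: avoiding_matrices_def simple_mat_def distinct_card)
  qed
  then show ?thesis by (auto simp: finite_nat_set_iff_bounded_le)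
qed

lemma avoiding_matrices_nonempty:
  assumes "dim_col F > 0"
  shows "dim_col ` avoiding_matrices m r F \<noteq> {}"
proof -
  have "mat m 0 (\<lambda>_. 0) \<in> avoiding_matrices m r F"
    using assms by (auto simp: avoiding_matrices_def r_matrix_def simple_mat_def cols_def
        elements_mat_def contains_configuration_def row_col_permutation_def dim_submatrix)
  then show ?thesis by blast
qed

definition M :: "nat mat" where
  "M = mat_of_rows_list 2 [[0, 1],
                           [0, 1],
                           [1, 0]]"

end

(* Fix a map sigma from the rows to the symbols 2, ..., r - 1. For a set S of rows let F S be the
   family of those A <= S for which the column with 1 on A, 0 on S - A and sigma off S occurs.
   Averaging over sigma, it suffices to bound the sum of (r-2)^(m-|S|) |F S| over all S. Avoiding M
   forces every F S to be a chain interrupted by antichains whose members differ by swapping two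
   elements, so |F S| is about 1 + |S| + (number of antichains), and only antichains {C+x, C+y} of
   size two attain the ratio 3/2. The gain over 3/2 comes from comparing different S. If x is swapped
   with y in S, then in S - y the element x is usually not swapped at all. If x is swapped
   with y in S - z and with z in S - y, then x, y, z cannot be paired up in S. For each set R of rows,
   consider the graph joining x and y when they are swapped in R + x + y and each is unswapped in
   R + x, R + y. The inequality 12 rho^2 + d (d - 1) >= 6 rho d, rho = r - 2, at the vertices of
   degree d > 0, summed over all R, yields the required number of elements outside pairs. *)
theory Submission
  imports Defs "HOL-Library.FuncSet"
begin

subsection \<open>Families without conflicts\<close>

text \<open>Inside a single S the ratio 3/2 cannot be improved: {}, {1}, {2}, {1,2}, {1,2,3},
  {1,2,4}, {1,2,3,4}, ... is free of conflicts and puts every element into a pair. This is why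
  \<open>no_conflict\<close> relates families of different row sets S and T: it asks only that the
  three rows lie in both, where the two columns read 0 or 1 whatever sigma is. The elements outside
  pairs are the \<open>inactive\<close> and the \<open>crowded\<close> ones. In the graph of R every
  vertex with an edge is an inactive element of a set one larger, which is enough when degrees are
  small; a vertex of large degree d carries d (d - 1) ordered pairs of edges, each forcing an
  inactive or crowded element in a set three larger. Vertices, edges and pairs of edges thus live
  one, two and three elements above R, so moving the sums to a common index multiplies them by rho,
  rho^2 and rho^3; the coefficients 12 rho^2, 6 rho and 1 make the inequality homogeneous. The
  charging is not injective: an inactive element pays for at most 2 exceptional ordered pairs, an
  inactive or crowded one for at most 8 ordered pairs of edges.\<close>

locale conflict_free =
  fixes F :: "'a set \<Rightarrow> 'a set set"
  assumes F_subset: "A \<in> F S \<Longrightarrow> A \<subseteq> S"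
    and no_conflict: "\<lbrakk>A \<in> F S; B \<in> F T; i \<in> A - B; j \<in> A - B; i \<noteq> j; l \<in> B - A;
      i \<in> T; j \<in> T; l \<in> S\<rbrakk> \<Longrightarrow> False"
begin

definition rel :: "'a set \<Rightarrow> 'a \<Rightarrow> 'a \<Rightarrow> bool" where
  "rel S x y \<longleftrightarrow> x \<noteq> y \<and> (\<exists>C. x \<notin> C \<and> y \<notin> C \<and> insert x C \<in> F S \<and> insert y C \<in> F S)"

text \<open>A complete square from C up to C + x + y. These are the pairs that may account for three
  members on two elements; the other pairs reach 5/2 at most on average.\<close>

definition full :: "'a set \<Rightarrow> 'a \<Rightarrow> 'a \<Rightarrow> bool" where
  "full S x y \<longleftrightarrow> x \<noteq> y \<and> (\<exists>C. x \<notin> C \<and> y \<notin> C \<and> C \<in> F S \<and>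
     insert x C \<in> F S \<and> insert y C \<in> F S \<and> insert x (insert y C) \<in> F S)"

definition partners :: "'a set \<Rightarrow> 'a \<Rightarrow> 'a set" where
  "partners S x = {y. rel S x y}"

definition inactive :: "'a set \<Rightarrow> 'a set" where
  "inactive S = {x \<in> S. partners S x = {}}"

definition paired :: "'a set \<Rightarrow> 'a set" where
  "paired S = {x \<in> S. card (partners S x) = 1}"

definition crowded :: "'a set \<Rightarrow> 'a set" where
  "crowded S = {x \<in> S. card (partners S x) \<ge> 2}"

text \<open>Pairs are ordered and a full partner is unique (\<open>full_partners\<close>), so the
  cardinality is the number of elements lying in full pairs.\<close>

definition full_pairs :: "'a set \<Rightarrow> ('a \<times> 'a) set" where
  "full_pairs S = {(x, y). full S x y}"

section \<open>Conflicts between full pairs and swaps\<close>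

lemma rel_sym: "rel S x y \<Longrightarrow> rel S y x"
  by (auto simp: rel_def)

lemma full_sym: "full S x y \<Longrightarrow> full S y x"
  by (auto simp: full_def insert_commute)

lemma rel_in: "rel S x y \<Longrightarrow> x \<in> S \<and> y \<in> S \<and> x \<noteq> y"
  using F_subset by (fastforce simp: rel_def)

lemma full_imp_rel: "full S x y \<Longrightarrow> rel S x y"
  by (auto simp: full_def rel_def)

lemma full_in: "full S x y \<Longrightarrow> x \<in> S \<and> y \<in> S \<and> x \<noteq> y"
  using full_imp_rel rel_in by blast

lemma partners_subset: "partners S x \<subseteq> S"
  using rel_in by (auto simp: partners_def)

text \<open>Wherever w lies relative to C and y relative to B, some corner of the square over C and
  one of B + x, B + w differ on x, y, w as two against one. The hypotheses on y and w put these
  three rows into both S and P, so this is a conflict.\<close>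

lemma full_rel_eq:
  assumes full: "full S x y" and rel: "rel P x w" and "y \<in> P" "w \<in> S"
  shows "w = y"
proof (rule ccontr)
  assume "w \<noteq> y"
  obtain C where C: "x \<noteq> y" "x \<notin> C" "y \<notin> C" "C \<in> F S" "insert x C \<in> F S" "insert y C \<in> F S"
    "insert x (insert y C) \<in> F S"
    using full by (auto simp: full_def)
  obtain B where B: "x \<noteq> w" "x \<notin> B" "w \<notin> B" "insert x B \<in> F P" "insert w B \<in> F P"
    using rel by (auto simp: rel_def)
  have in_SP: "x \<in> S" "y \<in> S" "x \<in> P" "w \<in> P"
    using full_in[OF full] rel_in[OF rel] by auto
  note facts = C B in_SP assms(3,4) \<open>w \<noteq> y\<close>
  consider "w \<in> C" "y \<in> B" | "w \<in> C" "y \<notin> B" | "w \<notin> C" "y \<in> B" | "w \<notin> C" "y \<notin> B"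
    by blast
  then show False
  proof cases
    case 1
    show False by (rule no_conflict[OF B(4) C(4), of x y w]) (use facts 1 in auto)
  next
    case 2
    show False by (rule no_conflict[OF C(6) B(4), of y w x]) (use facts 2 in auto)
  next
    case 3
    show False by (rule no_conflict[OF B(5) C(5), of w y x]) (use facts 3 in auto)
  next
    case 4
    show False by (rule no_conflict[OF C(7) B(5), of x y w]) (use facts 4 in auto)
  qed
qed

text \<open>Two disjoint swaps in the same family are stacked if one of them is a full square: the
  pair {z, w} sits entirely below the square of x and y or entirely above it.\<close>

lemma nested_pairs:
  assumes C: "x \<noteq> y" "x \<notin> C" "y \<notin> C" "C \<in> F P" "insert x C \<in> F P" "insert y C \<in> F P"
      "insert x (insert y C) \<in> F P"
    and D: "z \<noteq> w" "z \<notin> D" "w \<notin> D" "insert z D \<in> F P" "insert w D \<in> F P"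
    and ne: "z \<notin> {x, y}" "w \<notin> {x, y}"
  shows "z \<in> C \<and> w \<in> C \<and> x \<notin> D \<and> y \<notin> D \<or> z \<notin> C \<and> w \<notin> C \<and> x \<in> D \<and> y \<in> D"
proof -
  have inP: "x \<in> P" "y \<in> P" "z \<in> P" "w \<in> P"
    using F_subset[OF C(5)] F_subset[OF C(6)] F_subset[OF D(4)] F_subset[OF D(5)] by auto
  have 1: False if "x \<notin> D" "y \<notin> D" "z \<notin> C"
    by (rule no_conflict[OF C(7) D(4), of x y z]) (use assms inP that in auto)
  have 2: False if "x \<notin> D" "y \<notin> D" "w \<notin> C"
    by (rule no_conflict[OF C(7) D(5), of x y w]) (use assms inP that in auto)
  have 3: False if "x \<in> D" "y \<in> D" "z \<in> C"
    by (rule no_conflict[OF D(5) C(4), of x y z]) (use assms inP that in auto)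
  have 4: False if "x \<in> D" "y \<in> D" "w \<in> C"
    by (rule no_conflict[OF D(4) C(4), of x y w]) (use assms inP that in auto)
  \<comment> \<open>The set D cannot split x and y; \<open>u\<close> is the one inside D and
    \<open>v\<close> the one outside.\<close>
  have 5: False if "u \<in> D" "v \<notin> D" "z \<notin> C" "u = x \<and> v = y \<or> u = y \<and> v = x" for u v
    by (rule no_conflict[of "insert z D" P "insert v C" P u z v]) (use assms inP that in auto)
  have 6: False if "u \<in> D" "v \<notin> D" "z \<in> C" "u = x \<and> v = y \<or> u = y \<and> v = x" for u v
    by (rule no_conflict[of "insert v C" P "insert w D" P v z u]) (use assms inP that in auto)
  show ?thesis using 1 2 3 4 5 6 by blast
qed

text \<open>If z had a partner w in P, then {z, w} would be disjoint from {x, y} by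
  \<open>full_rel_eq\<close>, hence stacked with it. Whether w belongs to B is then forced one way
  by the square over C and the other way by the swap over D, although all three rows x, z, w survive
  in P - {y}.\<close>

lemma bad_inactive:
  assumes full: "full P x y" and rel: "rel (P - {y}) x z"
  shows "z \<in> inactive P"
proof (rule ccontr)
  have z: "z \<in> P" "z \<noteq> y" "z \<noteq> x" and x: "x \<in> P" using rel_in[OF rel] by auto
  assume "z \<notin> inactive P"
  then obtain w where w: "rel P z w" using z by (auto simp: inactive_def partners_def)
  have "w \<noteq> x" using full_rel_eq[OF full, of P z] rel_sym[OF w] z full_in[OF full] by auto
  moreover have "w \<noteq> y"
    using full_rel_eq[OF full_sym[OF full], of P z] rel_sym[OF w] z full_in[OF full] by auto
  ultimately have ne: "z \<notin> {x, y}" "w \<notin> {x, y}" using z by auto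
  obtain C where C: "x \<noteq> y" "x \<notin> C" "y \<notin> C" "C \<in> F P" "insert x C \<in> F P" "insert y C \<in> F P"
    "insert x (insert y C) \<in> F P"
    using full by (auto simp: full_def)
  obtain D where D: "z \<noteq> w" "z \<notin> D" "w \<notin> D" "insert z D \<in> F P" "insert w D \<in> F P"
    using w by (auto simp: rel_def)
  obtain B where B: "x \<noteq> z" "x \<notin> B" "z \<notin> B" "insert x B \<in> F (P - {y})" "insert z B \<in> F (P - {y})"
    using rel by (auto simp: rel_def)
  have wP: "w \<in> P" using rel_in[OF w] by auto
  note facts = C(1-3) D(1-3) B(1-3) ne wP x z
  from nested_pairs[OF C D ne] show False
  proof (elim disjE conjE)
    assume h: "z \<in> C" "w \<in> C" "x \<notin> D" "y \<notin> D"
    have "w \<in> B"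
    proof (rule ccontr)
      assume "w \<notin> B"
      then show False
        by (intro no_conflict[OF C(4) B(4), of z w x]) (use facts h in auto)
    qed
    then show False
      by (intro no_conflict[OF B(4) D(4), of x w z]) (use facts h in auto)
  next
    assume h: "z \<notin> C" "w \<notin> C" "x \<in> D" "y \<in> D"
    have "w \<notin> B"
    proof
      assume "w \<in> B"
      then show False
        by (intro no_conflict[OF B(5) C(5), of z w x]) (use facts h in auto)
    qed
    then show False
      by (intro no_conflict[OF D(5) B(5), of x w z]) (use facts h in auto)
  qed
qed

text \<open>Two different full pairs are disjoint and stacked. With {x, y} the lower one, the swaps
  of x with z and of c with z force x into E and c out of B, and then E + c and B + z conflict on x,
  c, z.\<close>

lemma bad_unique:
  assumes full1: "full P x y" and rel1: "rel (P - {y}) x z"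
    and full2: "full P c d" and rel2: "rel (P - {d}) c z"
  shows "(c, d) = (x, y) \<or> (c, d) = (y, x)"
proof (rule ccontr)
  have eq: "d = b" if "full P a b" "full P a d" for a b d
    using full_rel_eq[OF that(1) full_imp_rel[OF that(2)]] full_in that by blast
  assume neq: "\<not> ((c, d) = (x, y) \<or> (c, d) = (y, x))"
  have "c \<noteq> x" using eq[of x y d] full1 full2 neq by auto
  moreover have "c \<noteq> y" using eq[of y x d] full_sym[OF full1] full2 neq by auto
  moreover have "d \<noteq> x" using eq[of x y c] full1 full_sym[OF full2] neq by auto
  moreover have "d \<noteq> y" using eq[of y x c] full_sym[OF full1] full_sym[OF full2] neq by auto
  ultimately have ne: "c \<notin> {x, y}" "d \<notin> {x, y}" by auto
  obtain C where C: "x \<noteq> y" "x \<notin> C" "y \<notin> C" "C \<in> F P" "insert x C \<in> F P" "insert y C \<in> F P"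
    "insert x (insert y C) \<in> F P"
    using full1 by (auto simp: full_def)
  obtain D where D: "c \<noteq> d" "c \<notin> D" "d \<notin> D" "D \<in> F P" "insert c D \<in> F P" "insert d D \<in> F P"
    using full2 by (auto simp: full_def)
  obtain B where B: "x \<noteq> z" "x \<notin> B" "z \<notin> B" "insert x B \<in> F (P - {y})" "insert z B \<in> F (P - {y})"
    using rel1 by (auto simp: rel_def)
  obtain E where E: "c \<noteq> z" "c \<notin> E" "z \<notin> E" "insert c E \<in> F (P - {d})" "insert z E \<in> F (P - {d})"
    using rel2 by (auto simp: rel_def)
  have inP: "z \<in> P" "z \<noteq> y" "z \<noteq> d" "x \<in> P" "y \<in> P" "c \<in> P" "d \<in> P"
    using rel_in[OF rel1] rel_in[OF rel2] full_in[OF full1] full_in[OF full2] by auto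
  \<comment> \<open>The case of {x, y} below {c, d}, stated for arbitrary names so that the opposite
    order follows by exchanging the two pairs.\<close>
  have low: False
    if C: "x \<noteq> y" "x \<notin> C" "C \<in> F P" "insert x C \<in> F P"
      and D: "c \<noteq> d" "c \<notin> D" "D \<in> F P" "insert c D \<in> F P"
      and B: "x \<noteq> z" "x \<notin> B" "z \<notin> B" "insert x B \<in> F (P - {y})" "insert z B \<in> F (P - {y})"
      and E: "c \<noteq> z" "c \<notin> E" "z \<notin> E" "insert c E \<in> F (P - {d})" "insert z E \<in> F (P - {d})"
      and inP: "z \<in> P" "z \<noteq> y" "z \<noteq> d" "x \<in> P" "y \<in> P" "c \<in> P" "d \<in> P"
      and ne: "c \<notin> {x, y}" "d \<notin> {x, y}"
      and cC: "c \<notin> C" and xD: "x \<in> D"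
    for x y z c d B C D E
  proof -
    have "x \<in> E"
    proof (rule ccontr)
      assume "x \<notin> E"
      then show False
        using no_conflict[OF D(4) E(5), of c x z] no_conflict[OF D(3) E(4), of z x c]
          B E inP ne xD D(1,2) by auto
    qed
    moreover have "c \<notin> B"
    proof
      assume "c \<in> B"
      then show False
        using no_conflict[OF B(5) C(4), of z c x] no_conflict[OF B(4) C(3), of x c z]
          B E inP ne cC C(1,2) by auto
    qed
    ultimately show False
      using no_conflict[OF E(4) B(5), of x c z] B E inP ne C(1) D(1) by auto
  qed
  from nested_pairs[OF C D(1-3,5-6) ne] show False
  proof (elim disjE conjE)
    assume "c \<in> C" "x \<notin> D"
    then show False
      using low[OF D(1,2,4,5) C(1,2,4,5) E B inP(1,3,2,6,7,4,5)] ne by auto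
  next
    assume "c \<notin> C" "x \<in> D"
    then show False using low[OF C(1,2,4,5) D(1,2,4,5) B E inP ne] by auto
  qed
qed

subsection \<open>The size of a single family\<close>

text \<open>One element of A - B would force at least two into B - A, because B is larger, and these
  three rows conflict.\<close>

lemma smaller_subset:
  assumes "finite S" "A \<in> F S" "B \<in> F S" "card A < card B"
  shows "A \<subseteq> B"
proof (rule ccontr)
  assume "\<not> A \<subseteq> B"
  then obtain l where l: "l \<in> A - B" by auto
  have fin: "finite A" "finite B" using assms F_subset finite_subset by metis+
  have "card (A \<inter> B) < card A"
    using fin l by (intro psubset_card_mono) auto
  moreover have "card B = card (B - A) + card (A \<inter> B)"
    using fin by (metis card_Diff_subset_Int Int_commute card_mono finite_Int inf.cobounded2
        le_add_diff_inverse2)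
  ultimately have "2 \<le> card (B - A)" using assms(4) by linarith
  then obtain T where T: "T \<subseteq> B - A" "card T = 2"
    using obtain_subset_with_card_n by metis
  then obtain i j where "T = {i, j}" "i \<noteq> j" by (auto simp: card_2_iff)
  then show False
    using no_conflict[OF assms(3,2), of i j l] T(1) l F_subset[OF assms(2)] F_subset[OF assms(3)]
    by auto
qed

lemma same_card_swap:
  assumes "finite S" "A \<in> F S" "B \<in> F S" "card A = card B" "A \<noteq> B"
  obtains x y C where "x \<notin> C" "y \<notin> C" "x \<noteq> y" "A = insert x C" "B = insert y C"
proof -
  have fin: "finite A" "finite B" using assms F_subset finite_subset by metis+
  have eq: "card (A - B) = card (B - A)"
    using fin assms(4) by (simp add: card_Diff_subset_Int Int_commute)
  have sub: "A \<subseteq> S" "B \<subseteq> S" using F_subset assms by auto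
  have "card (A - B) \<noteq> 0"
  proof
    assume "card (A - B) = 0"
    then have "card (B - A) = 0" using eq by simp
    then have "A - B = {}" "B - A = {}" using \<open>card (A - B) = 0\<close> fin
      by (simp_all only: card_0_eq finite_Diff)
    then show False using assms(5) by blast
  qed
  moreover have "\<not> 2 \<le> card (A - B)"
  proof
    assume le: "2 \<le> card (A - B)"
    then obtain T where T: "T \<subseteq> A - B" "card T = 2"
      using obtain_subset_with_card_n by metis
    then obtain i j where ij: "T = {i, j}" "i \<noteq> j" by (auto simp: card_2_iff)
    have "B - A \<noteq> {}" using le eq by (metis card.empty not_numeral_le_zero)
    then obtain l where "l \<in> B - A" by auto
    then show False
      using no_conflict[OF assms(2,3), of i j l] T(1) ij sub by auto
  qed
  ultimately have "card (A - B) = 1" "card (B - A) = 1" using eq by linarith+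
  then obtain x y where "A - B = {x}" "B - A = {y}" by (metis card_1_singletonE)
  moreover from this have "A = insert x (A \<inter> B)" "B = insert y (A \<inter> B)" by blast+
  ultimately show thesis using that[of x "A \<inter> B" y] by blast
qed

section \<open>Levels of a family and the elements that move on them\<close>

definition level :: "'a set \<Rightarrow> nat \<Rightarrow> 'a set set" where
  "level S k = {A \<in> F S. card A = k}"

text \<open>The elements on which the members of a level disagree. For finite S these are the
  elements with a partner (\<open>rel_moving\<close>, \<open>level_rel\<close>), and since the sets
  for different levels are disjoint, members of a level can be charged to them.\<close>

definition moving :: "'a set \<Rightarrow> nat \<Rightarrow> 'a set" where
  "moving S k = \<Union>(level S k) - \<Inter>(level S k)"

lemma moving_iff: "x \<in> moving S k \<longleftrightarrow> (\<exists>A\<in>level S k. \<exists>B\<in>level S k. x \<in> A \<and> x \<notin> B)"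
  by (auto simp: moving_def)

text \<open>On the lower of two levels some member contains x, on the higher one some member omits
  it; but lower members are contained in higher ones.\<close>

lemma moving_unique:
  assumes "finite S" "x \<in> moving S j" "x \<in> moving S k"
  shows "j = k"
proof -
  have "\<not> j < k" if h: "x \<in> moving S j" "x \<in> moving S k" for j k
  proof
    assume "j < k"
    obtain A B where "A \<in> level S j" "x \<in> A" "B \<in> level S k" "x \<notin> B"
      using h by (auto simp: moving_iff)
    then show False using smaller_subset[OF assms(1), of A B] \<open>j < k\<close> by (auto simp: level_def)
  qed
  then show ?thesis using assms(2,3) by (meson linorder_neqE_nat)
qed

lemma finite_F: "finite S \<Longrightarrow> finite (F S)"
  using F_subset by (meson Pow_iff finite_Pow_iff finite_subset subsetI)

lemma finite_level: "finite S \<Longrightarrow> finite (level S k)"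
  using finite_F by (auto simp: level_def)

lemma level_finite_member: "finite S \<Longrightarrow> A \<in> level S k \<Longrightarrow> finite A"
  using F_subset finite_subset by (fastforce simp: level_def)

lemma relE_level:
  assumes "finite S" "rel S x y"
  obtains A B k where "A \<in> level S k" "B \<in> level S k" "x \<in> A" "x \<notin> B" "y \<in> B" "y \<notin> A"
    "B = insert y (A - {x})"
proof -
  obtain C where C: "x \<noteq> y" "x \<notin> C" "y \<notin> C" "insert x C \<in> F S" "insert y C \<in> F S"
    using assms by (auto simp: rel_def)
  have "finite C" using C(4) F_subset assms(1) finite_subset by (metis finite_insert)
  then have "insert x C \<in> level S (Suc (card C))" "insert y C \<in> level S (Suc (card C))"
    using C by (simp_all add: level_def)
  then show thesis by (rule that) (use C in auto)
qed

lemma rel_moving: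
  assumes "finite S" "rel S x y"
  shows "\<exists>k. x \<in> moving S k \<and> y \<in> moving S k"
proof -
  obtain A B k where "A \<in> level S k" "B \<in> level S k" "x \<in> A" "x \<notin> B" "y \<in> B" "y \<notin> A"
    using relE_level[OF assms] by metis
  then have "x \<in> moving S k" "y \<in> moving S k" unfolding moving_iff by blast+
  then show ?thesis by blast
qed

lemma level_rel:
  assumes "finite S" "A \<in> level S k" "B \<in> level S k" "x \<in> A" "x \<notin> B"
  obtains y where "rel S x y" "y \<in> B" "y \<notin> A" "A = insert x (B - {y})" "B = insert y (A - {x})"
proof -
  obtain u v C where uv: "u \<notin> C" "v \<notin> C" "u \<noteq> v" "A = insert u C" "B = insert v C"
    by (rule same_card_swap[OF assms(1), of A B]) (use assms in \<open>auto simp: level_def\<close>)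
  have "u = x" using uv(4,5) assms(4,5) by blast
  then have "rel S x v" using uv assms(2,3) unfolding rel_def level_def by blast
  then show thesis using that[of v] uv \<open>u = x\<close> by auto
qed

lemma level_two:
  assumes "finite S" "card (level S k) = 2"
  obtains x y C where "x \<noteq> y" "x \<notin> C" "y \<notin> C" "level S k = {insert x C, insert y C}"
    "moving S k = {x, y}" "partners S x = {y}" "partners S y = {x}"
proof -
  obtain A B where AB: "level S k = {A, B}" "A \<noteq> B"
    using assms(2) by (auto simp: card_2_iff)
  then have "A \<in> level S k" "B \<in> level S k" by auto
  then have mem: "A \<in> F S" "B \<in> F S" "card A = card B" by (auto simp: level_def)
  obtain x y C where xy: "x \<notin> C" "y \<notin> C" "x \<noteq> y" "A = insert x C" "B = insert y C"
    by (rule same_card_swap[OF assms(1) mem AB(2)])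
  have mov: "moving S k = {x, y}"
    using xy unfolding moving_def AB(1) by auto
  have uniq: "z = v" if "rel S u z" "{u, v} = {x, y}" "u \<noteq> v" for u v z
  proof -
    obtain j where j: "u \<in> moving S j" "z \<in> moving S j" using rel_moving[OF assms(1) \<open>rel S u z\<close>] by auto
    then have "j = k" using moving_unique[OF assms(1), of u j k] mov that by auto
    then show ?thesis using j mov that rel_in[OF that(1)] by auto
  qed
  have "rel S x y" using mem(1,2) xy unfolding rel_def by blast
  moreover from this have "rel S y x" by (rule rel_sym)
  moreover have "z = y" if "rel S x z" for z using uniq[OF that, of y] xy(3) by simp
  moreover have "z = x" if "rel S y z" for z using uniq[OF that, of x] xy(3) by (simp add: insert_commute)
  ultimately have "partners S x = {y}" "partners S y = {x}" unfolding partners_def by blast+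
  moreover have "level S k = {insert x C, insert y C}" using AB(1) xy(4,5) by simp
  ultimately show thesis using that[OF xy(3,1,2)] mov by simp
qed

text \<open>With x in A but not in B, a third set E is compared with whichever of A and B disagrees
  with it at x. The resulting partner of x is new, since the old one would make E equal to A or
  B.\<close>

lemma level_three_crowded:
  assumes "finite S" "card (level S k) \<ge> 3"
  shows "moving S k \<subseteq> crowded S"
proof
  fix x assume "x \<in> moving S k"
  then obtain A B where AB: "A \<in> level S k" "B \<in> level S k" "x \<in> A" "x \<notin> B"
    by (auto simp: moving_iff)
  have "\<exists>E. E \<in> level S k - {A, B}"
  proof (rule ccontr)
    assume "\<not> ?thesis"
    then have "card (level S k) \<le> card {A, B}" by (intro card_mono) auto
    also have "\<dots> \<le> 2" by (simp add: card_insert_if)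
    finally show False using assms(2) by simp
  qed
  then obtain E where E: "E \<in> level S k" "E \<noteq> A" "E \<noteq> B" by auto
  obtain y where y: "rel S x y" "A = insert x (B - {y})" "y \<in> B" "y \<notin> A" "B = insert y (A - {x})"
    by (rule level_rel[OF assms(1) AB])
  obtain y' where y': "rel S x y'" "y' \<noteq> y"
  proof (cases "x \<in> E")
    case True
    obtain y' where "rel S x y'" "E = insert x (B - {y'})"
      by (rule level_rel[OF assms(1) E(1) AB(2) True AB(4)])
    then show thesis using that[of y'] y(2) E(2) by blast
  next
    case False
    obtain y' where "rel S x y'" "E = insert y' (A - {x})"
      by (rule level_rel[OF assms(1) AB(1) E(1) AB(3) False])
    then show thesis using that[of y'] y(5) E(3) by blast
  qed
  have "finite (partners S x)" using partners_subset assms(1) finite_subset by metis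
  then have "card {y, y'} \<le> card (partners S x)"
    using y y' by (intro card_mono) (auto simp: partners_def)
  then show "x \<in> crowded S" using y' rel_in[OF y(1)] by (auto simp: crowded_def)
qed

text \<open>A level is a clique of a Johnson graph: either all members are C + e for a common C, or
  all are G - e for a common G. The labels e are distinct and each of them moves.\<close>

lemma level_card_le_moving:
  assumes "finite S" "card (level S k) \<ge> 2"
  shows "card (level S k) \<le> card (moving S k)"
proof -
  have fin: "finite (moving S k)"
    using level_finite_member[OF assms(1)] finite_level[OF assms(1)] by (auto simp: moving_def)
  obtain A B where AB: "A \<in> level S k" "B \<in> level S k" "A \<noteq> B"
    using assms(2) by (metis card_le_Suc0_iff_eq finite_level[OF assms(1)] not_less_eq_eq numeral_2_eq_2)
  have mem: "A \<in> F S" "B \<in> F S" "card A = card B" using AB by (auto simp: level_def)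
  obtain x y C where xy: "x \<notin> C" "y \<notin> C" "x \<noteq> y" "A = insert x C" "B = insert y C"
    by (rule same_card_swap[OF assms(1) mem AB(3)])
  have inS: "x \<in> S" "y \<in> S" "C \<subseteq> S" using F_subset[OF mem(1)] F_subset[OF mem(2)] xy by auto
  have third: "(\<exists>e. e \<notin> C \<and> e \<notin> {x, y} \<and> E = insert e C) \<or> (\<exists>e\<in>C. E = insert x (insert y C) - {e})"
    if E: "E \<in> level S k" "E \<noteq> A" "E \<noteq> B" for E
  proof -
    have mE: "E \<in> F S" "card A = card E" "card B = card E"
      using E AB by (auto simp: level_def)
    obtain a e X where a: "a \<notin> X" "e \<notin> X" "a \<noteq> e" "A = insert a X" "E = insert e X"
      by (rule same_card_swap[OF assms(1) mem(1) mE(1,2)]) (use E in auto)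
    obtain b f Y where b: "b \<notin> Y" "f \<notin> Y" "b \<noteq> f" "B = insert b Y" "E = insert f Y"
      by (rule same_card_swap[OF assms(1) mem(2) mE(1,3)]) (use E in auto)
    have eA: "e \<notin> A" "e \<in> E" "E = insert e (A - {a})" "a \<in> A" "a \<notin> E" using a by auto
    have fB: "f \<notin> B" "f \<in> E" "E = insert f (B - {b})" "b \<in> B" "b \<notin> E" using b by auto
    show ?thesis
    proof (cases "a = x")
      case True
      then have "E = insert e C" using eA(3) xy(1,4) by auto
      moreover have "e \<notin> C" "e \<noteq> x" using eA(1) xy(4) by auto
      moreover have "e \<noteq> y" using calculation(1) E(3) xy(5) by auto
      ultimately show ?thesis by blast
    next
      case False
      then have "x \<in> E" using eA(3) xy(4) by auto
      then have "f = x" using fB(3) xy(1,3,5) by auto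
      then have "E = insert x (insert y C) - {b}" using fB(3,4) xy(1,3,5) by auto
      moreover have "b \<noteq> y"
      proof
        assume "b = y"
        then have "E = A" using fB(3) \<open>f = x\<close> xy(2,4,5) by auto
        then show False using E(2) by simp
      qed
      then have "b \<in> C" using fB(4) xy(5) by auto
      ultimately show ?thesis by blast
    qed
  qed
  \<comment> \<open>The two types of clique exclude each other: (C + x + y) - e' has x and y against
    e in C + e.\<close>
  have mixed: False
    if "e \<notin> C" "e \<notin> {x, y}" "insert e C \<in> level S k" "e' \<in> C"
      "insert x (insert y C) - {e'} \<in> level S k" for e e'
  proof -
    have "insert e C \<in> F S" "insert x (insert y C) - {e'} \<in> F S" using that by (auto simp: level_def)
    then show False
      using no_conflict[of "insert x (insert y C) - {e'}" S "insert e C" S x y e]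
        that inS xy F_subset[of "insert e C" S] by auto
  qed
  show ?thesis
  proof (cases "\<exists>e\<in>C. insert x (insert y C) - {e} \<in> level S k")
    case True
    define G where "G = insert x (insert y C)"
    have "\<exists>e\<in>G. E = G - {e}" if E: "E \<in> level S k" for E
    proof (cases "E = A \<or> E = B")
      case True
      then have "E = G - {y} \<or> E = G - {x}" using xy(1-5) by (auto simp: G_def)
      then show ?thesis by (auto simp: G_def)
    next
      case False
      then have "\<not> (\<exists>e. e \<notin> C \<and> e \<notin> {x, y} \<and> E = insert e C)" using mixed True E by blast
      then obtain e where "e \<in> C" "E = insert x (insert y C) - {e}"
        using third[OF E] False by blast
      then show ?thesis by (auto simp: G_def)
    qed
    then obtain g where g: "\<And>E. E \<in> level S k \<Longrightarrow> g E \<in> G \<and> E = G - {g E}" by metis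
    have inj: "inj_on g (level S k)" using g by (metis inj_onI)
    have "g E \<in> moving S k" if E: "E \<in> level S k" for E
    proof -
      obtain E' where E': "E' \<in> level S k" "E' \<noteq> E" using AB by metis
      have "g E \<noteq> g E'" using g[OF E] g[OF E'(1)] E'(2) by metis
      then have "g E \<in> G - {g E'}" "g E \<notin> G - {g E}" using g[OF E, THEN conjunct1] by simp_all
      then have "g E \<in> E'" "g E \<notin> E" using g[OF E] g[OF E'(1)] by metis+
      then show ?thesis using E E'(1) unfolding moving_iff by blast
    qed
    then show ?thesis using inj fin by (intro card_inj_on_le[of g]) auto
  next
    case no: False
    have "\<exists>e. e \<notin> C \<and> E = insert e C" if E: "E \<in> level S k" for E
    proof (cases "E = A \<or> E = B")
      case True
      then show ?thesis using xy(1,2,4,5) by blast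
    next
      case False
      then show ?thesis using third[OF E] no E by blast
    qed
    then obtain g where g: "\<And>E. E \<in> level S k \<Longrightarrow> g E \<notin> C \<and> E = insert (g E) C" by metis
    have inj: "inj_on g (level S k)" using g by (metis inj_onI)
    have "g E \<in> moving S k" if E: "E \<in> level S k" for E
    proof -
      obtain E' where E': "E' \<in> level S k" "E' \<noteq> E" using AB by metis
      have "g E \<noteq> g E'" using g[OF E] g[OF E'(1)] E'(2) by metis
      then have "g E \<notin> insert (g E') C" "g E \<in> insert (g E) C" using g[OF E, THEN conjunct1] by simp_all
      then have "g E \<notin> E'" "g E \<in> E" using g[OF E] g[OF E'(1)] by metis+
      then show ?thesis using E E'(1) unfolding moving_iff by blast
    qed
    then show ?thesis using inj fin by (intro card_inj_on_le[of g]) auto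
  qed
qed

section \<open>Members alone on their level, and the size of a family\<close>

definition single :: "'a set \<Rightarrow> 'a set set" where
  "single S = {A \<in> F S. level S (card A) = {A}}"

lemma not_moving_inactive:
  assumes "finite S" "x \<in> S" "\<And>k. x \<notin> moving S k"
  shows "x \<in> inactive S"
  using assms rel_moving[OF assms(1)] by (auto simp: inactive_def partners_def)

text \<open>A member \<open>A\<close> alone on its level and not of least size is charged to an element missing from
  all smaller members, which is inactive; if there is none, then \<open>A\<close> is the union of the next
  nonempty level below.\<close>

lemma single_above:
  assumes "finite S"
  shows "card (single S) \<le> 1 + card (inactive S) + card {k. card (level S k) \<ge> 2 \<and> \<Union>(level S k) \<in> F S}"
proof -
  define low where "low A = {B \<in> F S. card B < card A}" for A :: "'a set"
  define T1 where "T1 = {A \<in> single S. low A = {}}"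
  define T2 where "T2 = {A \<in> single S. \<not> A \<subseteq> \<Union>(low A)}"
  define T3 where "T3 = {A \<in> single S. low A \<noteq> {} \<and> A \<subseteq> \<Union>(low A)}"
  define K where "K = {k. card (level S k) \<ge> 2 \<and> \<Union>(level S k) \<in> F S}"
  have finF: "finite (F S)" by (rule finite_F[OF assms])
  have single_sub: "single S \<subseteq> F S" by (auto simp: single_def)
  have single_eq: "A = B" if "A \<in> single S" "B \<in> F S" "card B = card A" for A B
  proof -
    have "B \<in> level S (card A)" using that by (simp add: level_def)
    then show ?thesis using that(1) by (auto simp: single_def)
  qed
  have finS: "finite (single S)" using finF single_sub finite_subset by blast
  have fin_mem: "finite A" if "A \<in> F S" for A using that F_subset assms finite_subset by metis
  have K_sub: "K \<subseteq> card ` F S"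
  proof
    fix k assume "k \<in> K"
    then have "level S k \<noteq> {}" by (auto simp: K_def)
    then show "k \<in> card ` F S" by (auto simp: level_def)
  qed
  then have finK: "finite K" using finF by (meson finite_imageI finite_subset)
  have "card T1 \<le> 1"
  proof -
    have "A = B" if "A \<in> T1" "B \<in> T1" for A B
    proof -
      have "\<not> card A < card B" "\<not> card B < card A"
        using that single_sub by (auto simp: T1_def low_def)
      then show ?thesis using that single_eq[of A B] single_sub by (auto simp: T1_def)
    qed
    then show ?thesis using finS by (metis (no_types, lifting) One_nat_def T1_def card_le_Suc0_iff_eq
          finite_subset mem_Collect_eq subsetI)
  qed
  moreover have "card T2 \<le> card (inactive S)"
  proof -
    have "\<forall>A\<in>T2. \<exists>x. x \<in> A \<and> x \<notin> \<Union>(low A)" by (auto simp: T2_def)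
    then obtain g where g: "\<And>A. A \<in> T2 \<Longrightarrow> g A \<in> A \<and> g A \<notin> \<Union>(low A)" by metis
    have neq: "g A \<noteq> g B" if "A \<in> T2" "B \<in> T2" "card A < card B" for A B
      using g[OF that(1)] g[OF that(2)] that single_sub by (auto simp: T2_def low_def)
    have "inj_on g T2"
    proof (rule inj_onI)
      fix A B assume h: "A \<in> T2" "B \<in> T2" "g A = g B"
      then have "card A = card B" using neq by (metis linorder_neqE_nat)
      then show "A = B" using single_eq[of A B] h single_sub by (auto simp: T2_def)
    qed
    moreover have "g A \<in> inactive S" if A: "A \<in> T2" for A
    proof (rule not_moving_inactive[OF assms])
      have AF: "A \<in> single S" "A \<in> F S" using A single_sub by (auto simp: T2_def)
      show "g A \<in> S" using g[OF A] F_subset[OF AF(2)] by auto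
      \<comment> \<open>Level \<open>card A\<close> consists of \<open>A\<close> alone, lower
        members omit \<open>g A\<close>, and higher members contain \<open>A\<close>; so no level
        disagrees on \<open>g A\<close>.\<close>
      fix k show "g A \<notin> moving S k"
      proof
        assume "g A \<in> moving S k"
        then obtain B E where BE: "B \<in> level S k" "E \<in> level S k" "g A \<in> B" "g A \<notin> E"
          by (auto simp: moving_iff)
        have "k \<noteq> card A" using BE single_eq[OF AF(1)] by (auto simp: level_def)
        moreover have "\<not> k < card A" using BE g[OF A] by (auto simp: low_def level_def)
        moreover have "\<not> card A < k"
          using BE g[OF A] smaller_subset[OF assms AF(2), of E] by (auto simp: level_def)
        ultimately show False by linarith
      qed
    qed
    moreover have "finite (inactive S)" using assms by (auto simp: inactive_def)
    ultimately show ?thesis by (intro card_inj_on_le[of g]) auto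
  qed
  moreover have "card T3 \<le> card K"
  proof -
    have "T3 \<subseteq> (\<lambda>k. \<Union>(level S k)) ` K"
    proof
      fix A assume A: "A \<in> T3"
      then have AF: "A \<in> F S" and ne: "low A \<noteq> {}" and sub: "A \<subseteq> \<Union>(low A)"
        using single_sub by (auto simp: T3_def)
      define k where "k = Max (card ` low A)"
      have finlow: "finite (low A)" using finF by (auto simp: low_def)
      then have "k \<in> card ` low A" using ne unfolding k_def by (intro Max_in) auto
      then obtain B where B: "B \<in> low A" "card B = k" by auto
      have max: "card E \<le> k" if "E \<in> low A" for E
        using that finlow unfolding k_def by (intro Max_ge) auto
      have lev_low: "E \<in> low A" if "E \<in> level S k" for E
        using that B by (auto simp: low_def level_def)
      have lev: "B \<in> level S k" using B by (auto simp: low_def level_def)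
      have low_sub: "E \<subseteq> \<Union>(level S k)" if "E \<in> low A" for E
      proof (cases "card E = k")
        case True
        then show ?thesis using that by (auto simp: low_def level_def)
      next
        case False
        then have "card E < card B" using max[OF that] B by auto
        then have "E \<subseteq> B" using smaller_subset[OF assms, of E B] that B by (auto simp: low_def)
        then show ?thesis using lev by auto
      qed
      have "\<Union>(level S k) \<subseteq> A"
        using smaller_subset[OF assms _ AF] lev_low by (auto simp: low_def)
      then have eq: "A = \<Union>(level S k)" using sub low_sub by blast
      have "card (level S k) \<ge> 2"
      proof (rule ccontr)
        assume "\<not> ?thesis"
        then have "card (level S k) \<le> Suc 0" by simp
        then have "level S k = {B}"
          using lev finite_level[OF assms] by (auto simp: card_le_Suc0_iff_eq)
        then have "A = B" using eq by simp
        then show False using B by (auto simp: low_def)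
      qed
      then show "A \<in> (\<lambda>k. \<Union>(level S k)) ` K" using eq AF by (auto simp: K_def)
    qed
    then show ?thesis using finK surj_card_le by blast
  qed
  moreover have "card (single S) \<le> card T1 + card T2 + card T3"
  proof -
    have "single S \<subseteq> T1 \<union> T2 \<union> T3" by (auto simp: T1_def T2_def T3_def)
    then have "card (single S) \<le> card (T1 \<union> T2 \<union> T3)"
      using finS by (intro card_mono) (auto simp: T1_def T2_def T3_def)
    also have "\<dots> \<le> card T1 + card T2 + card T3"
      by (meson card_Un_le add_le_mono1 le_trans)
    finally show ?thesis .
  qed
  ultimately show ?thesis unfolding K_def by linarith
qed

text \<open>Complementation within \<open>S\<close> turns this into the previous lemma.\<close>

lemma single_below:
  assumes "finite S"
  shows "card (single S) \<le> 1 + card (inactive S) + card {k. card (level S k) \<ge> 2 \<and> \<Inter>(level S k) \<in> F S}"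
proof -
  define G where "G T = (\<lambda>A. T - A) ` F T" for T
  have G_iff: "A \<in> G T \<longleftrightarrow> A \<subseteq> T \<and> T - A \<in> F T" for A T
    using F_subset[of _ T] by (auto simp: G_def image_iff double_diff)
  \<comment> \<open>Complementing both sets exchanges their roles in a conflict. The requirements
    that i, j lie in one row set and l in the other are what puts these rows into the
    complements.\<close>
  interpret co: conflict_free G
  proof
    show "A \<subseteq> T" if "A \<in> G T" for A T using that by (simp add: G_iff)
    show False if h: "A \<in> G T" "B \<in> G Q" "i \<in> A - B" "j \<in> A - B" "i \<noteq> j" "l \<in> B - A"
      "i \<in> Q" "j \<in> Q" "l \<in> T" for A B T Q i j l
      by (rule no_conflict[of "Q - B" Q "T - A" T i j l]) (use h in \<open>auto simp: G_iff\<close>)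
  qed
  have compl: "insert y (S - insert x (insert y C)) = S - insert x C"
    if "insert y C \<subseteq> S" "x \<noteq> y" "y \<notin> C" for x y C
    using that by auto
  have rel1: "co.rel S x y" if r: "rel S x y" for x y
  proof -
    obtain C where C: "x \<noteq> y" "x \<notin> C" "y \<notin> C" "insert x C \<in> F S" "insert y C \<in> F S"
      using r by (auto simp: rel_def)
    have sub: "insert x C \<subseteq> S" "insert y C \<subseteq> S" using C F_subset by blast+
    have "S - insert x C \<in> G S" "S - insert y C \<in> G S"
      using C(4,5) by (auto simp: G_def)
    then have "insert x (S - insert y (insert x C)) \<in> G S" "insert y (S - insert x (insert y C)) \<in> G S"
      using compl[OF sub(1) C(1)[symmetric] C(2)] compl[OF sub(2) C(1) C(3)] by simp_all
    then show ?thesis unfolding co.rel_def using C(1)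
      by (intro conjI exI[of _ "S - insert x (insert y C)"]) (auto simp: insert_commute)
  qed
  have rel2: "rel S x y" if r: "co.rel S x y" for x y
  proof -
    obtain C where C: "x \<noteq> y" "x \<notin> C" "y \<notin> C" "insert x C \<in> G S" "insert y C \<in> G S"
      using r by (auto simp: co.rel_def)
    have sub: "insert x C \<subseteq> S" "insert y C \<subseteq> S" and "S - insert x C \<in> F S" "S - insert y C \<in> F S"
      using C by (auto simp: G_iff)
    then have "insert x (S - insert y (insert x C)) \<in> F S" "insert y (S - insert x (insert y C)) \<in> F S"
      using compl[OF sub(1) C(1)[symmetric] C(2)] compl[OF sub(2) C(1) C(3)] by simp_all
    then show ?thesis unfolding rel_def using C(1)
      by (intro conjI exI[of _ "S - insert x (insert y C)"]) (auto simp: insert_commute)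
  qed
  have "co.rel S = rel S" using rel1 rel2 by blast
  then have inactive: "co.inactive S = inactive S"
    by (simp add: co.inactive_def inactive_def co.partners_def partners_def)
  have inj: "inj_on (\<lambda>A. S - A) (F S)"
    using F_subset by (intro inj_onI) blast
  have card_compl: "card (S - A) = card S - card A" if "A \<in> F S" for A
    using F_subset[OF that] assms by (simp add: card_Diff_subset finite_subset)
  have card_le: "card A \<le> card S" if "A \<in> F S" for A
    using F_subset[OF that] assms by (simp add: card_mono)
  \<comment> \<open>Complementation reverses the levels. For k above \<open>card S\<close> the
    truncated difference would wrongly name level 0.\<close>
  have level: "co.level S (card S - k) = (\<lambda>A. S - A) ` level S k" if "k \<le> card S" for k
    using card_compl card_le that by (force simp: co.level_def level_def G_def)
  have "card (single S) \<le> card (co.single S)"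
  proof (rule card_inj_on_le[of "\<lambda>A. S - A"])
    show "inj_on (\<lambda>A. S - A) (single S)"
      using inj by (rule inj_on_subset) (auto simp: single_def)
    show "(\<lambda>A. S - A) ` single S \<subseteq> co.single S"
      using level card_compl card_le by (auto simp: single_def co.single_def G_def)
    show "finite (co.single S)"
      using co.finite_F[OF assms] by (simp add: co.single_def)
  qed
  also have "\<dots> \<le> 1 + card (inactive S) +
      card {k. card (co.level S k) \<ge> 2 \<and> \<Union>(co.level S k) \<in> G S}"
    using co.single_above[OF assms] inactive by simp
  also have "card {k. card (co.level S k) \<ge> 2 \<and> \<Union>(co.level S k) \<in> G S} \<le>
      card {k. card (level S k) \<ge> 2 \<and> \<Inter>(level S k) \<in> F S}"
  proof (rule card_inj_on_le[of "\<lambda>k. card S - k"])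
    have le: "k \<le> card S" if h: "2 \<le> card (co.level S k)" for k
    proof -
      obtain A where "A \<in> co.level S k" using h by (metis card.empty equals0I not_numeral_le_zero)
      then show ?thesis using co.F_subset[of A S] assms by (auto simp: co.level_def card_mono)
    qed
    show "inj_on (\<lambda>k. card S - k) {k. card (co.level S k) \<ge> 2 \<and> \<Union>(co.level S k) \<in> G S}"
      by (intro inj_onI) (metis (mono_tags, lifting) diff_diff_cancel le mem_Collect_eq)
    show "(\<lambda>k. card S - k) ` {k. card (co.level S k) \<ge> 2 \<and> \<Union>(co.level S k) \<in> G S}
       \<subseteq> {k. card (level S k) \<ge> 2 \<and> \<Inter>(level S k) \<in> F S}"
    proof (intro image_subsetI CollectI)
      fix k assume "k \<in> {k. card (co.level S k) \<ge> 2 \<and> \<Union>(co.level S k) \<in> G S}"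
      then have k: "card (co.level S k) \<ge> 2" "\<Union>(co.level S k) \<in> G S" by auto
      define j where "j = card S - k"
      have lev: "co.level S k = (\<lambda>A. S - A) ` level S j"
        using level[of j] le[OF k(1)] by (simp add: j_def)
      have "card (co.level S k) \<le> card (level S j)"
        unfolding lev by (rule card_image_le[OF finite_level[OF assms]])
      then have two: "card (level S j) \<ge> 2" using k by simp
      then obtain B where B: "B \<in> level S j" by (metis card.empty equals0I not_numeral_le_zero)
      then have "B \<subseteq> S" using F_subset by (auto simp: level_def)
      then have "S - \<Union>(co.level S k) = \<Inter>(level S j)"
        unfolding lev using B by auto
      then have "\<Inter>(level S j) \<in> F S" using k(2) by (simp add: G_iff)
      then show "card (level S (card S - k)) \<ge> 2 \<and> \<Inter>(level S (card S - k)) \<in> F S"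
        using two by (simp add: j_def)
    qed
    have "{k. card (level S k) \<ge> 2 \<and> \<Inter>(level S k) \<in> F S} \<subseteq> {..card S}"
    proof (intro subsetI, elim CollectE conjE)
      fix k assume "card (level S k) \<ge> 2"
      then obtain B where "B \<in> level S k" by (metis card.empty equals0I not_numeral_le_zero)
      then show "k \<in> {..card S}" using card_le by (auto simp: level_def)
    qed
    then show "finite {k. card (level S k) \<ge> 2 \<and> \<Inter>(level S k) \<in> F S}"
      using finite_subset by blast
  qed
  finally show ?thesis by simp
qed

lemma card_partition:
  assumes "finite S"
  shows "card S = card (inactive S) + card (paired S) + card (crowded S)"
proof -
  have fin: "finite (partners S x)" for x using partners_subset assms finite_subset by metis
  have S: "S = inactive S \<union> paired S \<union> crowded S"
  proof -
    have "x \<in> inactive S \<union> paired S \<union> crowded S" if "x \<in> S" for x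
    proof -
      consider "card (partners S x) = 0" | "card (partners S x) = 1" | "card (partners S x) \<ge> 2"
        by linarith
      then show ?thesis using that fin by cases (auto simp: inactive_def paired_def crowded_def)
    qed
    then show ?thesis by (auto simp: inactive_def paired_def crowded_def)
  qed
  have "card (inactive S \<union> paired S \<union> crowded S)
      = card (inactive S \<union> paired S) + card (crowded S)"
    using assms by (intro card_Un_disjoint) (auto simp: inactive_def paired_def crowded_def)
  also have "card (inactive S \<union> paired S) = card (inactive S) + card (paired S)"
    using assms by (intro card_Un_disjoint) (auto simp: inactive_def paired_def)
  finally show ?thesis using S by simp
qed

lemma finite_full_pairs: "finite S \<Longrightarrow> finite (full_pairs S)"
  by (rule finite_subset[of _ "S \<times> S"]) (use full_in in \<open>auto simp: full_pairs_def\<close>)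

lemma full_partners: "full S x y \<Longrightarrow> partners S x = {y}"
  using full_rel_eq[of S x y S] full_imp_rel full_in rel_in unfolding partners_def by blast

lemma full_pairs_le_paired:
  assumes "finite S"
  shows "card (full_pairs S) \<le> card (paired S)"
proof (rule card_inj_on_le[of fst])
  show "inj_on fst (full_pairs S)"
    using full_partners unfolding inj_on_def full_pairs_def by clarsimp blast
  show "fst ` full_pairs S \<subseteq> paired S"
    using full_partners full_in by (auto simp: full_pairs_def paired_def)
  show "finite (paired S)" using assms by (simp add: paired_def)
qed

lemma card_UN_moving:
  assumes "finite S" "finite K"
  shows "card (\<Union>k\<in>K. moving S k) = (\<Sum>k\<in>K. card (moving S k))"
proof (rule card_UN_disjoint[OF assms(2)])
  show "\<forall>k\<in>K. finite (moving S k)"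
    using level_finite_member[OF assms(1)] finite_level[OF assms(1)] by (auto simp: moving_def)
  show "\<forall>i\<in>K. \<forall>j\<in>K. i \<noteq> j \<longrightarrow> moving S i \<inter> moving S j = {}"
    using moving_unique[OF assms(1)] by auto
qed

text \<open>In twelfths per element, the bound allows 12 for an inactive element, 15 for a paired
  one, 18 for one in a full pair and 16 for a crowded one. A two-member level has 2 members on two
  elements; it pays for half a single member, and for another half if both its union and its
  intersection are members. A level of k >= 3 members has at least k moving elements and pays for
  one single member, a ratio of at most 4/3.\<close>

lemma card_F_bound:
  assumes "finite S"
  shows "12 * card (F S) \<le> 12 + 12 * card S + 3 * card (paired S) + 3 * card (full_pairs S)
    + 4 * card (crowded S)"
proof -
  define KU where "KU = {k. card (level S k) \<ge> 2 \<and> \<Union>(level S k) \<in> F S}"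
  define KI where "KI = {k. card (level S k) \<ge> 2 \<and> \<Inter>(level S k) \<in> F S}"
  define K2 where "K2 = {k. card (level S k) = 2}"
  define K3 where "K3 = {k. card (level S k) \<ge> 3}"
  define L3 where "L3 = (\<Sum>k\<in>K3. card (level S k))"
  have bounded: "{k. card (level S k) \<ge> 2} \<subseteq> {..card S}"
  proof (intro subsetI, elim CollectE)
    fix k assume "card (level S k) \<ge> 2"
    then obtain B where "B \<in> level S k" by (metis card.empty equals0I not_numeral_le_zero)
    then show "k \<in> {..card S}" using F_subset assms by (auto simp: level_def card_mono)
  qed
  have fin2: "finite {k. card (level S k) \<ge> 2}" using bounded finite_subset by blast
  have fin: "finite K2" "finite K3" "finite KU" "finite KI"
    by (rule finite_subset[OF _ fin2]; auto simp: K2_def K3_def KU_def KI_def)+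
  have total: "card (F S) \<le> card (single S) + 2 * card K2 + L3"
  proof -
    have "F S \<subseteq> single S \<union> (\<Union>k\<in>K2. level S k) \<union> (\<Union>k\<in>K3. level S k)"
    proof
      fix A assume A: "A \<in> F S"
      then have lev: "A \<in> level S (card A)" by (simp add: level_def)
      have "card (level S (card A)) \<noteq> 0" using lev finite_level[OF assms] by auto
      then consider "card (level S (card A)) = 1" | "card A \<in> K2" | "card A \<in> K3"
        unfolding K2_def K3_def by fastforce
      then show "A \<in> single S \<union> (\<Union>k\<in>K2. level S k) \<union> (\<Union>k\<in>K3. level S k)"
      proof cases
        case 1
        then have "level S (card A) = {A}" using lev by (metis card_1_singletonE singletonD)
        then show ?thesis using A by (simp add: single_def)
      qed (use lev in auto)
    qed
    then have "card (F S) \<le> card (single S \<union> (\<Union>k\<in>K2. level S k) \<union> (\<Union>k\<in>K3. level S k))"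
      using fin finite_level[OF assms] finite_F[OF assms] by (intro card_mono) (auto simp: single_def)
    also have "\<dots> \<le> card (single S) + card (\<Union>k\<in>K2. level S k) + card (\<Union>k\<in>K3. level S k)"
      by (meson card_Un_le add_le_mono1 le_trans)
    also have "card (\<Union>k\<in>K2. level S k) \<le> (\<Sum>k\<in>K2. card (level S k))"
      by (rule card_UN_le[OF fin(1)])
    also have "(\<Sum>k\<in>K2. card (level S k)) = 2 * card K2" by (simp add: K2_def)
    also have "card (\<Union>k\<in>K3. level S k) \<le> L3"
      unfolding L3_def by (rule card_UN_le[OF fin(2)])
    finally show ?thesis by simp
  qed
  \<comment> \<open>The bounds from above and from below are added, so that a two-member level
    counts twice only if both its union and its intersection are members.\<close>
  have singles: "2 * card (single S) \<le> 2 + 2 * card (inactive S) + card K2 + card (K2 \<inter> KU \<inter> KI) + 2 * card K3"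
  proof -
    have "card (single S) \<le> 1 + card (inactive S) + card KU"
      "card (single S) \<le> 1 + card (inactive S) + card KI"
      using single_above[OF assms] single_below[OF assms] by (simp_all add: KU_def KI_def)
    moreover have "card KU + card KI = card (KU \<union> KI) + card (KU \<inter> KI)"
      by (rule card_Un_Int[OF fin(3,4)])
    moreover have "card (KU \<union> KI) \<le> card K2 + card K3"
    proof -
      have "card (KU \<union> KI) \<le> card (K2 \<union> K3)"
        using fin by (intro card_mono) (auto simp: KU_def KI_def K2_def K3_def)
      then show ?thesis using card_Un_le le_trans by blast
    qed
    moreover have "card (KU \<inter> KI) \<le> card (K2 \<inter> KU \<inter> KI) + card K3"
    proof -
      have "card (KU \<inter> KI) \<le> card ((K2 \<inter> KU \<inter> KI) \<union> K3)"
        using fin by (intro card_mono) (auto simp: KU_def KI_def K2_def K3_def)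
      then show ?thesis using card_Un_le le_trans by blast
    qed
    ultimately show ?thesis by linarith
  qed
  have paired: "2 * card K2 \<le> card (paired S)"
  proof -
    have card2: "card (moving S k) = 2" and sub: "moving S k \<subseteq> paired S" if k: "k \<in> K2" for k
    proof -
      have "card (level S k) = 2" using k by (simp add: K2_def)
      then obtain x y where xy: "x \<noteq> y" "moving S k = {x, y}" "partners S x = {y}" "partners S y = {x}"
        by (elim level_two[OF assms])
      then show "card (moving S k) = 2" by simp
      have "x \<in> S" "y \<in> S" using xy(3,4) partners_subset by blast+
      then show "moving S k \<subseteq> paired S" using xy by (simp add: paired_def)
    qed
    have "2 * card K2 = (\<Sum>k\<in>K2. card (moving S k))" using card2 by simp
    also have "\<dots> = card (\<Union>k\<in>K2. moving S k)" by (rule card_UN_moving[OF assms fin(1), symmetric])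
    also have "\<dots> \<le> card (paired S)"
      using sub assms by (intro card_mono) (auto simp: paired_def)
    finally show ?thesis .
  qed
  have full: "2 * card (K2 \<inter> KU \<inter> KI) \<le> card (full_pairs S)"
  proof -
    have card2: "card (moving S k) = 2" and sub: "moving S k \<subseteq> fst ` full_pairs S"
      if k: "k \<in> K2 \<inter> KU \<inter> KI" for k
    proof -
      have "card (level S k) = 2" using k by (simp add: K2_def)
      then obtain x y C where xy: "x \<noteq> y" "x \<notin> C" "y \<notin> C"
        "level S k = {insert x C, insert y C}" "moving S k = {x, y}"
        by (elim level_two[OF assms])
      then show "card (moving S k) = 2" by simp
      have "\<Union>(level S k) = insert x (insert y C)" "\<Inter>(level S k) = C" using xy by auto
      then have "insert x (insert y C) \<in> F S" "C \<in> F S" using k by (auto simp: KU_def KI_def)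
      moreover have "insert x C \<in> level S k" "insert y C \<in> level S k" using xy(4) by simp_all
      then have "insert x C \<in> F S" "insert y C \<in> F S" by (simp_all add: level_def)
      ultimately have f: "full S x y" using xy(1-3) unfolding full_def by blast
      then have "(x, y) \<in> full_pairs S" "(y, x) \<in> full_pairs S"
        using full_sym by (auto simp: full_pairs_def)
      then show "moving S k \<subseteq> fst ` full_pairs S" using xy(5) by force
    qed
    have finK: "finite (K2 \<inter> KU \<inter> KI)" using fin by simp
    have "2 * card (K2 \<inter> KU \<inter> KI) = (\<Sum>k\<in>K2 \<inter> KU \<inter> KI. card (moving S k))" using card2 by simp
    also have "\<dots> = card (\<Union>k\<in>K2 \<inter> KU \<inter> KI. moving S k)"
      by (rule card_UN_moving[OF assms finK, symmetric])
    also have "\<dots> \<le> card (fst ` full_pairs S)"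
      using sub finite_full_pairs[OF assms] by (intro card_mono) auto
    also have "\<dots> \<le> card (full_pairs S)" by (rule card_image_le[OF finite_full_pairs[OF assms]])
    finally show ?thesis .
  qed
  have crowded: "L3 \<le> card (crowded S)"
  proof -
    have "L3 \<le> (\<Sum>k\<in>K3. card (moving S k))"
      unfolding L3_def using level_card_le_moving[OF assms] by (intro sum_mono) (auto simp: K3_def)
    also have "\<dots> = card (\<Union>k\<in>K3. moving S k)" by (rule card_UN_moving[OF assms fin(2), symmetric])
    also have "\<dots> \<le> card (crowded S)"
      using level_three_crowded[OF assms] assms by (intro card_mono) (auto simp: K3_def crowded_def)
    finally show ?thesis .
  qed
  have "card K3 * 3 \<le> L3"
    unfolding L3_def using sum_bounded_below[of K3 3 "\<lambda>k. card (level S k)"] by (simp add: K3_def)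
  then show ?thesis
    using total singles paired full crowded card_partition[OF assms] by linarith
qed

end

subsection \<open>Bad pairs and cherries\<close>

lemma card_le_fibres:
  assumes "finite B" "f ` A \<subseteq> B" "\<And>b. b \<in> B \<Longrightarrow> card {a \<in> A. f a = b} \<le> n"
  shows "card A \<le> n * card B"
proof -
  have fibres: "(\<Union>b\<in>B. {a \<in> A. f a = b}) = A" using assms(2) by auto
  have "card (\<Union>b\<in>B. {a \<in> A. f a = b}) \<le> (\<Sum>b\<in>B. card {a \<in> A. f a = b})"
    by (rule card_UN_le[OF assms(1)])
  then have "card A \<le> (\<Sum>b\<in>B. card {a \<in> A. f a = b})" unfolding fibres .
  also have "\<dots> \<le> (\<Sum>b\<in>B. n)" by (rule sum_mono[OF assms(3)])
  also have "\<dots> = n * card B" by simp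
  finally show ?thesis .
qed

lemma card_pair_le: "card {a, b} \<le> 2"
  by (cases "a = b") auto

text \<open>Every vertex has at most one out-neighbour \<open>h x\<close>. Seen from one vertex a,
  every other vertex is \<open>h a\<close> or points to a, and two vertices pointing to a cannot
  point to each other.\<close>

lemma card_tournament_le_three:
  assumes "finite T" "\<And>x y. x \<in> T \<Longrightarrow> y \<in> T \<Longrightarrow> x \<noteq> y \<Longrightarrow> h x = y \<or> h y = x"
  shows "card T \<le> 3"
proof (cases "T = {}")
  case False
  then obtain a where a: "a \<in> T" by auto
  define U where "U = {c \<in> T. c \<noteq> a \<and> h c = a}"
  have "c = d" if "c \<in> U" "d \<in> U" for c d
    using that assms(2)[of c d] unfolding U_def by blast
  moreover have finU: "finite U" using assms(1) by (simp add: U_def)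
  ultimately have "card U \<le> 1" by (simp add: card_le_Suc0_iff_eq)
  have "T \<subseteq> {a, h a} \<union> U" using assms(2)[OF a] by (auto simp: U_def)
  then have "card T \<le> card ({a, h a} \<union> U)" using finU by (intro card_mono) auto
  also have "\<dots> \<le> card {a, h a} + card U" by (rule card_Un_le)
  also have "\<dots> \<le> 2 + 1" using \<open>card U \<le> 1\<close> by (intro add_mono card_pair_le)
  finally show ?thesis by simp
qed simp

context conflict_free
begin

text \<open>The edges of the graph attached to R. That x and y lie outside R is imposed separately
  where edges are counted.\<close>

definition good :: "'a set \<Rightarrow> 'a \<Rightarrow> 'a \<Rightarrow> bool" where
  "good R x y \<longleftrightarrow> full (insert x (insert y R)) x y \<and>
     x \<in> inactive (insert x R) \<and> y \<in> inactive (insert y R)"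

text \<open>If a full pair fails to be good, one of its elements is swapped with some z once the
  other is removed. This z is inactive in P by \<open>bad_inactive\<close>, and by
  \<open>bad_unique\<close> it determines the pair up to order, hence the factor 2.\<close>

lemma card_bad_pairs:
  assumes "finite P"
  shows "card {(x, y). full P x y \<and> \<not> good (P - {x, y}) x y} \<le> 2 * card (inactive P)"
proof -
  define bad where "bad x y z \<longleftrightarrow> full P x y \<and> (rel (P - {y}) x z \<or> rel (P - {x}) y z)" for x y z
  define X where "X = {(x, y). full P x y \<and> \<not> good (P - {x, y}) x y}"
  have "\<exists>z. bad x y z" if "(x, y) \<in> X" for x y
  proof -
    have f: "full P x y" and ng: "\<not> good (P - {x, y}) x y" using that by (auto simp: X_def)
    have in_P: "x \<in> P" "y \<in> P" "x \<noteq> y" using full_in[OF f] by auto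
    then have "insert x (P - {x, y}) = P - {y}" "insert y (P - {x, y}) = P - {x}"
      "insert x (insert y (P - {x, y})) = P" by auto
    then have "x \<notin> inactive (P - {y}) \<or> y \<notin> inactive (P - {x})"
      using ng f by (simp add: good_def)
    then show ?thesis using in_P f by (auto simp: bad_def inactive_def partners_def)
  qed
  then have "\<forall>p\<in>X. \<exists>z. bad (fst p) (snd p) z" by auto
  then obtain g where "\<forall>p\<in>X. bad (fst p) (snd p) (g p)" by metis
  then have g: "bad x y (g (x, y))" if "(x, y) \<in> X" for x y using that by fastforce
  have inactive: "z \<in> inactive P" if "bad x y z" for x y z
    using that bad_inactive[of P x y z] bad_inactive[of P y x z] full_sym by (auto simp: bad_def)
  have unique: "(c, d) = (x, y) \<or> (c, d) = (y, x)" if b: "bad x y z" "bad c d z" for x y c d z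
  proof -
    obtain x' y' where 1: "full P x' y'" "rel (P - {y'}) x' z" "(x', y') = (x, y) \<or> (x', y') = (y, x)"
      using b(1) full_sym unfolding bad_def by blast
    obtain c' d' where 2: "full P c' d'" "rel (P - {d'}) c' z" "(c', d') = (c, d) \<or> (c', d') = (d, c)"
      using b(2) full_sym unfolding bad_def by blast
    show ?thesis using bad_unique[OF 1(1,2) 2(1,2)] 1(3) 2(3) by auto
  qed
  have "card X \<le> 2 * card (inactive P)"
  proof (rule card_le_fibres[of _ g])
    show "finite (inactive P)" using assms by (simp add: inactive_def)
    show "g ` X \<subseteq> inactive P" using g inactive by force
    fix z
    show "card {p \<in> X. g p = z} \<le> 2"
    proof (cases "{p \<in> X. g p = z} = {}")
      case False
      then obtain x y where xy: "(x, y) \<in> X" "g (x, y) = z" by auto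
      have "{p \<in> X. g p = z} \<subseteq> {(x, y), (y, x)}"
        using unique[of x y z] g[OF xy(1)] xy(2) g by fastforce
      then have "card {p \<in> X. g p = z} \<le> card {(x, y), (y, x)}" by (rule card_mono[rotated]) simp
      also have "\<dots> \<le> 2" by (rule card_pair_le)
      finally show ?thesis .
    next
      case True
      show ?thesis unfolding True by simp
    qed
  qed
  then show ?thesis by (simp add: X_def)
qed

text \<open>Two edges at k in the graph of R = P - {k, a, b}, of which only the fullness is kept: P
  - {b} is R + k + a and P - {a} is R + k + b.\<close>

definition cherry :: "'a set \<Rightarrow> 'a \<Rightarrow> 'a \<Rightarrow> 'a \<Rightarrow> bool" where
  "cherry P k a b \<longleftrightarrow> a \<noteq> b \<and> full (P - {b}) k a \<and> full (P - {a}) k b"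

lemma cherry_sym: "cherry P k a b \<Longrightarrow> cherry P k b a"
  by (auto simp: cherry_def)

lemma cherry_in: "cherry P k a b \<Longrightarrow> k \<in> P \<and> a \<in> P \<and> b \<in> P \<and> k \<noteq> a \<and> k \<noteq> b \<and> a \<noteq> b"
  using full_in by (fastforce simp: cherry_def)

text \<open>\<open>full_rel_eq\<close> applies across the two sets unless one of the partners is the
  element removed from the other set.\<close>

lemma full_removed:
  assumes "full (P - {b}) k a" "full (P - {d}) k c"
  shows "a = c \<or> a = d \<or> c = b"
  using full_rel_eq[OF assms(1) full_imp_rel[OF assms(2)]] full_in[OF assms(1)] full_in[OF assms(2)]
  by auto

lemma cherry_unique:
  assumes "cherry P k a b" "cherry P k c d"
  shows "(c, d) = (a, b) \<or> (c, d) = (b, a)"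
proof -
  have ab: "full (P - {b}) k a" "full (P - {a}) k b" and cd: "full (P - {d}) k c" "full (P - {c}) k d"
    and ne: "a \<noteq> b" "c \<noteq> d"
    using assms by (auto simp: cherry_def)
  show ?thesis
    using full_removed[OF ab(1) cd(1)] full_removed[OF ab(1) cd(2)]
      full_removed[OF ab(2) cd(1)] full_removed[OF ab(2) cd(2)] ne by auto
qed

text \<open>A parity argument. By fullness in P - {b} and P - {a}, all partners in P of k, a, b stay
  among these three. If each had exactly one partner, three elements would be perfectly
  matched.\<close>

lemma cherry_target:
  assumes "finite P" "cherry P k a b"
  shows "\<exists>y\<in>{k, a, b}. y \<in> inactive P \<union> crowded P"
proof (rule ccontr)
  assume no: "\<not> ?thesis"
  have ch: "full (P - {b}) k a" "full (P - {a}) k b" and in_P: "k \<in> P" "a \<in> P" "b \<in> P"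
    and ne: "k \<noteq> a" "k \<noteq> b" "a \<noteq> b"
    using cherry_in[OF assms(2)] assms(2) by (auto simp: cherry_def)
  have within: "w \<in> {k, a, b}" if r: "rel P x w" and x: "x \<in> {k, a, b}" for x w
  proof (rule ccontr)
    assume w: "w \<notin> {k, a, b}"
    have "w \<in> P" using rel_in[OF r] by auto
    then show False
      using full_rel_eq[OF ch(1), of P w] full_rel_eq[OF full_sym[OF ch(1)], of P w]
        full_rel_eq[OF full_sym[OF ch(2)], of P w] r x w in_P by auto
  qed
  have ex: "\<exists>w. partners P x = {w}" if x: "x \<in> {k, a, b}" for x
  proof -
    have "finite (partners P x)" using partners_subset assms(1) finite_subset by metis
    moreover have "x \<in> P" using x in_P by auto
    ultimately have "card (partners P x) \<noteq> 0" "\<not> card (partners P x) \<ge> 2"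
      using no x by (auto simp: inactive_def crowded_def)
    then have "card (partners P x) = 1" by linarith
    then show ?thesis by (metis card_1_singletonE)
  qed
  obtain u v w where p: "partners P k = {u}" "partners P a = {v}" "partners P b = {w}"
    using ex[of k] ex[of a] ex[of b] by auto
  then have r: "rel P k u" "rel P a v" "rel P b w" by (auto simp: partners_def)
  have "u \<in> {a, b}" "v \<in> {k, b}" "w \<in> {k, a}"
    using within[OF r(1)] within[OF r(2)] within[OF r(3)] rel_in[OF r(1)] rel_in[OF r(2)] rel_in[OF r(3)]
    by auto
  moreover have "k \<in> partners P u" "a \<in> partners P v" "b \<in> partners P w"
    using r rel_sym by (auto simp: partners_def)
  ultimately show False using p ne by auto
qed

text \<open>Each cherry is charged to an element y given by \<open>cherry_target\<close>. A centre k
  has at most the two orderings of one cherry. The centre is y itself or has y as a leaf; the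
  centres of the second kind form a tournament in which k points only to the other leaf of its
  cherry, so there are at most three. Hence 8 = 2 * (1 + 3).\<close>

lemma card_cherries:
  assumes "finite P"
  shows "card {(k, a, b). cherry P k a b} \<le> 8 * (card (inactive P) + card (crowded P))"
proof -
  define X where "X = {(k, a, b). cherry P k a b}"
  have "X \<subseteq> P \<times> P \<times> P" using cherry_in by (auto simp: X_def)
  then have finX: "finite X" using assms finite_subset by blast
  have centres: "card Y \<le> 2 * card (fst ` Y)" if Y: "Y \<subseteq> X" for Y
  proof (rule card_le_fibres[of _ fst])
    show "finite (fst ` Y)" using Y finX finite_subset by blast
    fix k assume "k \<in> fst ` Y"
    then obtain a b where kab: "(k, a, b) \<in> Y" by auto
    have "{p \<in> Y. fst p = k} \<subseteq> {(k, a, b), (k, b, a)}"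
      using cherry_unique[of P k a b] kab Y by (fastforce simp: X_def)
    then have "card {p \<in> Y. fst p = k} \<le> card {(k, a, b), (k, b, a)}" by (rule card_mono[rotated]) simp
    also have "\<dots> \<le> 2" by (rule card_pair_le)
    finally show "card {p \<in> Y. fst p = k} \<le> 2" .
  qed simp
  have "\<forall>p\<in>X. \<exists>y. y \<in> {fst p, fst (snd p), snd (snd p)} \<and> y \<in> inactive P \<union> crowded P"
    using cherry_target[OF assms] by (fastforce simp: X_def)
  then obtain g where gX: "\<forall>p\<in>X. g p \<in> {fst p, fst (snd p), snd (snd p)} \<and> g p \<in> inactive P \<union> crowded P"
    by metis
  have g: "g (k, a, b) \<in> {k, a, b}" if "(k, a, b) \<in> X" for k a b using gX that by fastforce
  have "card X \<le> 8 * card (inactive P \<union> crowded P)"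
  proof (rule card_le_fibres[of _ g])
    show "finite (inactive P \<union> crowded P)" using assms by (simp add: inactive_def crowded_def)
    show "g ` X \<subseteq> inactive P \<union> crowded P" using gX by blast
    fix y
    define Y where "Y = {p \<in> X. g p = y}"
    define T where "T = {k. \<exists>b. cherry P k y b}"
    have finT: "finite T" using cherry_in assms by (intro finite_subset[of T P]) (auto simp: T_def)
    define h where "h k = (SOME b. cherry P k y b)" for k
    have h: "cherry P k y (h k)" if "k \<in> T" for k
      using that unfolding T_def h_def by (auto intro: someI_ex)
    have "card T \<le> 3"
    proof (rule card_tournament_le_three[OF finT])
      fix k c assume kc: "k \<in> T" "c \<in> T" "k \<noteq> c"
      have "full (P - {h k}) y k" "full (P - {h c}) y c"
        using h[OF kc(1)] h[OF kc(2)] full_sym by (auto simp: cherry_def)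
      then show "h k = c \<or> h c = k" using full_removed kc(3) by blast
    qed
    have "fst ` Y \<subseteq> insert y T"
    proof
      fix k assume "k \<in> fst ` Y"
      then obtain a b where "(k, a, b) \<in> X" "g (k, a, b) = y" by (auto simp: Y_def)
      then have "y \<in> {k, a, b}" "cherry P k a b" using g[of k a b] by (auto simp: X_def)
      then show "k \<in> insert y T" using cherry_sym[of P k a b] by (auto simp: T_def)
    qed
    then have "card (fst ` Y) \<le> card (insert y T)" using finT by (intro card_mono) auto
    also have "\<dots> \<le> 4" using \<open>card T \<le> 3\<close> finT by (simp add: card_insert_if)
    finally show "card {p \<in> X. g p = y} \<le> 8"
      using centres[of Y] by (auto simp: Y_def)
  qed
  also have "\<dots> \<le> 8 * (card (inactive P) + card (crowded P))"
    by (intro mult_le_mono2 card_Un_le)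
  finally show ?thesis by (simp add: X_def)
qed

lemma good_cherry:
  assumes "k \<in> P" "a \<in> P" "b \<in> P" "k \<noteq> a" "k \<noteq> b" "a \<noteq> b"
    and "good (P - {k, a, b}) k a" "good (P - {k, a, b}) k b"
  shows "cherry P k a b"
proof -
  have "insert k (insert a (P - {k, a, b})) = P - {b}" "insert k (insert b (P - {k, a, b})) = P - {a}"
    using assms by auto
  then show ?thesis using assms by (simp add: good_def cherry_def)
qed

end

subsection \<open>Weighted sums over all row sets\<close>

text \<open>For \<rho> = 1 equality holds at d = 3 and d = 4, so 12 is the least coefficient that
  goes with 6. Between these values the real quadratic is negative: integrality of d is
  essential.\<close>

lemma degree_inequality:
  fixes d \<rho> :: nat
  assumes "\<rho> \<ge> 1"
  shows "6 * \<rho> * d \<le> 12 * \<rho>\<^sup>2 + d * (d - 1)"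
proof -
  define t where "t = 2 * int d - 6 * int \<rho> - 1"
  \<comment> \<open>four times the difference of the two sides is \<open>t\<^sup>2 + 12 \<rho> (\<rho> - 1) - 1\<close>, and \<open>t\<close> is odd\<close>
  have "odd t" by (simp add: t_def)
  then have "t \<noteq> 0" by auto
  then have "t\<^sup>2 \<ge> 1" using zero_less_power2[of t] by linarith
  define a b where "a = 12 * (int \<rho>)\<^sup>2 + int d * (int d - 1) - 6 * int \<rho> * int d"
    and "b = int \<rho> * (int \<rho> - 1)"
  have "b \<ge> 0" using assms by (simp add: b_def)
  moreover have "4 * a = t\<^sup>2 + 12 * b - 1"
    by (simp add: t_def a_def b_def power2_eq_square algebra_simps)
  ultimately have "a \<ge> 0" using \<open>t\<^sup>2 \<ge> 1\<close> by linarith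
  then have "6 * int \<rho> * int d \<le> 12 * (int \<rho>)\<^sup>2 + int d * (int d - 1)" by (simp add: a_def)
  moreover have "int d * (int d - 1) = int (d * (d - 1))" by (cases d) (auto simp: algebra_simps)
  ultimately have "int (6 * \<rho> * d) \<le> int (12 * \<rho>\<^sup>2 + d * (d - 1))" by simp
  then show ?thesis by linarith
qed

text \<open>For each t substitute P = R + \<open>s t\<close>, a disjoint union; the size grows by j,
  so the weight loses the factor \<rho>^j. The predicate \<open>Q\<close> always speaks of the
  smaller set.\<close>

lemma weighted_shift:
  fixes \<rho> :: nat
  assumes "finite V" "finite U" "\<And>t. t \<in> U \<Longrightarrow> s t \<subseteq> V \<and> card (s t) = j"
  shows "(\<Sum>R\<in>Pow V. \<rho> ^ (card V - card R) * card {t \<in> U. s t \<inter> R = {} \<and> Q R t})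
       = \<rho> ^ j * (\<Sum>P\<in>Pow V. \<rho> ^ (card V - card P) * card {t \<in> U. s t \<subseteq> P \<and> Q (P - s t) t})"
proof -
  have count: "card {t \<in> U. B t} = (\<Sum>t\<in>U. if B t then 1 else 0)" for B
    using assms(2) by (simp add: sum.If_cases Int_def)
  have shift: "(\<Sum>R\<in>{R \<in> Pow V. s t \<inter> R = {} \<and> Q R t}. \<rho> ^ (card V - card R))
      = \<rho> ^ j * (\<Sum>P\<in>{P \<in> Pow V. s t \<subseteq> P \<and> Q (P - s t) t}. \<rho> ^ (card V - card P))"
    if t: "t \<in> U" for t
    unfolding sum_distrib_left
  proof (rule sum.reindex_bij_witness[of _ "\<lambda>P. P - s t" "\<lambda>R. R \<union> s t"])
    fix R assume R: "R \<in> {R \<in> Pow V. s t \<inter> R = {} \<and> Q R t}"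
    then have "R \<union> s t - s t = R" by auto
    then show "R \<union> s t - s t = R" "R \<union> s t \<in> {P \<in> Pow V. s t \<subseteq> P \<and> Q (P - s t) t}"
      using R assms(3)[OF t] by auto
    have fin: "finite R" "finite (s t)" using R assms(1) assms(3)[OF t] finite_subset by auto
    then have "card (R \<union> s t) = card R + j"
      using R assms(3)[OF t] by (subst card_Un_disjoint) auto
    moreover have "card (R \<union> s t) \<le> card V" using R assms(1) assms(3)[OF t] by (intro card_mono) auto
    ultimately have "card V - card R = j + (card V - card (R \<union> s t))" by linarith
    then show "\<rho> ^ j * \<rho> ^ (card V - card (R \<union> s t)) = \<rho> ^ (card V - card R)" by (simp add: power_add)
  qed auto
  have "(\<Sum>R\<in>Pow V. \<rho> ^ (card V - card R) * card {t \<in> U. s t \<inter> R = {} \<and> Q R t})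
      = (\<Sum>t\<in>U. \<Sum>R\<in>Pow V. if s t \<inter> R = {} \<and> Q R t then \<rho> ^ (card V - card R) else 0)"
    unfolding count sum_distrib_left by (subst sum.swap) (intro sum.cong, auto)
  also have "\<dots> = (\<Sum>t\<in>U. \<Sum>R\<in>{R \<in> Pow V. s t \<inter> R = {} \<and> Q R t}. \<rho> ^ (card V - card R))"
    using assms(1) by (simp only: sum.inter_filter finite_Pow_iff)
  also have "\<dots> = (\<Sum>t\<in>U. \<rho> ^ j * (\<Sum>P\<in>{P \<in> Pow V. s t \<subseteq> P \<and> Q (P - s t) t}. \<rho> ^ (card V - card P)))"
    using shift by (rule sum.cong[OF refl])
  also have "\<dots> = \<rho> ^ j * (\<Sum>t\<in>U. \<Sum>P\<in>Pow V. if s t \<subseteq> P \<and> Q (P - s t) t then \<rho> ^ (card V - card P) else 0)"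
    using assms(1) by (simp only: sum.inter_filter finite_Pow_iff sum_distrib_left[symmetric])
  also have "(\<Sum>t\<in>U. \<Sum>P\<in>Pow V. if s t \<subseteq> P \<and> Q (P - s t) t then \<rho> ^ (card V - card P) else 0)
      = (\<Sum>P\<in>Pow V. \<rho> ^ (card V - card P) * card {t \<in> U. s t \<subseteq> P \<and> Q (P - s t) t})"
    unfolding count sum_distrib_left by (subst sum.swap) (intro sum.cong, auto)
  finally show ?thesis .
qed

lemma sum_weights:
  fixes \<rho> :: nat
  assumes "finite V"
  shows "(\<Sum>P\<in>Pow V. \<rho> ^ (card V - card P)) = (1 + \<rho>) ^ card V"
  using assms
proof (induction V rule: finite_induct)
  case (insert x V)
  have "(\<Sum>P\<in>Pow (insert x V). \<rho> ^ (card (insert x V) - card P))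
      = (\<Sum>P\<in>Pow V. \<rho> ^ (card (insert x V) - card P))
        + (\<Sum>P\<in>insert x ` Pow V. \<rho> ^ (card (insert x V) - card P))"
    unfolding Pow_insert using insert.hyps by (intro sum.union_disjoint) auto
  also have "(\<Sum>P\<in>insert x ` Pow V. \<rho> ^ (card (insert x V) - card P))
      = (\<Sum>P\<in>Pow V. \<rho> ^ (card (insert x V) - card (insert x P)))"
    using insert.hyps by (intro sum.reindex_cong[of "insert x"] inj_onI) auto
  also have "\<dots> = (\<Sum>P\<in>Pow V. \<rho> ^ (card V - card P))"
  proof (intro sum.cong refl)
    fix P assume "P \<in> Pow V"
    then have "finite P" "x \<notin> P" using insert.hyps finite_subset by auto
    then show "\<rho> ^ (card (insert x V) - card (insert x P)) = \<rho> ^ (card V - card P)"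
      using insert.hyps by simp
  qed
  also have "(\<Sum>P\<in>Pow V. \<rho> ^ (card (insert x V) - card P)) = \<rho> * (\<Sum>P\<in>Pow V. \<rho> ^ (card V - card P))"
    unfolding sum_distrib_left
  proof (intro sum.cong refl)
    fix P assume "P \<in> Pow V"
    then have "card P \<le> card V" using insert.hyps by (simp add: card_mono)
    then show "\<rho> ^ (card (insert x V) - card P) = \<rho> * \<rho> ^ (card V - card P)"
      using insert.hyps by (simp add: Suc_diff_le)
  qed
  finally show ?case using insert by (simp add: algebra_simps)
qed simp

text \<open>Shifting one element shows that \<rho> times the weighted sum of |P| is the weighted sum
  of |V| - |P|; adding the weighted sum of |P| leaves |V| times the total weight.\<close>

lemma sum_weighted_card:
  fixes \<rho> :: nat
  assumes "finite V"
  shows "(1 + \<rho>) * (\<Sum>P\<in>Pow V. \<rho> ^ (card V - card P) * card P) = card V * (1 + \<rho>) ^ card V"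
proof -
  let ?w = "\<lambda>P. \<rho> ^ (card V - card P)"
  \<comment> \<open>The conjunct \<open>True\<close> is the instance of \<open>Q\<close> in
    \<open>weighted_shift\<close>.\<close>
  have "\<rho> * (\<Sum>P\<in>Pow V. ?w P * card P) = \<rho> ^ 1 * (\<Sum>P\<in>Pow V. ?w P * card {x \<in> V. {x} \<subseteq> P \<and> True})"
    unfolding power_one_right
    by (intro arg_cong[of _ _ "(*) \<rho>"] sum.cong refl arg_cong2[of _ _ _ _ "(*)"] arg_cong[of _ _ card]) auto
  also have "\<dots> = (\<Sum>R\<in>Pow V. ?w R * card {x \<in> V. {x} \<inter> R = {} \<and> True})"
    by (rule weighted_shift[symmetric]) (use assms in auto)
  also have "\<dots> = (\<Sum>R\<in>Pow V. ?w R * (card V - card R))"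
  proof (intro sum.cong refl arg_cong2[of _ _ _ _ "(*)"])
    fix R assume "R \<in> Pow V"
    then have "{x \<in> V. {x} \<inter> R = {} \<and> True} = V - R" "finite R" "R \<subseteq> V"
      using assms finite_subset by auto
    then show "card {x \<in> V. {x} \<inter> R = {} \<and> True} = card V - card R" by (simp add: card_Diff_subset)
  qed
  finally have "(1 + \<rho>) * (\<Sum>P\<in>Pow V. ?w P * card P)
      = (\<Sum>P\<in>Pow V. ?w P * card P) + (\<Sum>P\<in>Pow V. ?w P * (card V - card P))"
    by (simp add: algebra_simps)
  also have "\<dots> = (\<Sum>P\<in>Pow V. ?w P * card V)"
    unfolding sum.distrib[symmetric]
    by (intro sum.cong refl) (use assms in \<open>simp add: distrib_left[symmetric] card_mono\<close>)
  also have "\<dots> = card V * (1 + \<rho>) ^ card V"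
    using sum_weights[OF assms] by (simp add: sum_distrib_right[symmetric])
  finally show ?thesis .
qed

section \<open>From the graphs of all row sets to the weighted bound\<close>

context conflict_free
begin

text \<open>In the graph on V - R the edge set \<open>?G\<close>, counted with order, has the sum of
  the degrees d as its size, and \<open>?C\<close> has the sum of d (d - 1). Every vertex with an
  edge belongs to \<open>?N\<close>, because \<open>good\<close> makes its ends inactive, so
  \<open>degree_inequality\<close> can be summed over the vertices.\<close>

lemma local_inequality:
  fixes \<rho> :: nat
  assumes "finite V" "R \<subseteq> V" "\<rho> \<ge> 1"
  shows "6 * \<rho> * card {t \<in> {(x, y). x \<in> V \<and> y \<in> V \<and> x \<noteq> y}. {fst t, snd t} \<inter> R = {} \<and> good R (fst t) (snd t)}
    \<le> 12 * \<rho>\<^sup>2 * card {k \<in> V. {k} \<inter> R = {} \<and> k \<in> inactive (insert k R)}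
      + card {t \<in> {(k, a, b). k \<in> V \<and> a \<in> V \<and> b \<in> V \<and> k \<noteq> a \<and> k \<noteq> b \<and> a \<noteq> b}.
          {fst t, fst (snd t), snd (snd t)} \<inter> R = {} \<and> good R (fst t) (fst (snd t)) \<and> good R (fst t) (snd (snd t))}"
    (is "6 * \<rho> * card ?G \<le> 12 * \<rho>\<^sup>2 * card ?N + card ?C")
proof -
  define W where "W = V - R"
  define adj where "adj k = {y \<in> W. y \<noteq> k \<and> good R k y}" for k
  have fin: "finite W" "finite (adj k)" for k using assms by (auto simp: W_def adj_def)
  have G: "?G = Sigma W adj"
    unfolding W_def adj_def by auto
  have C: "?C = Sigma W (\<lambda>k. Sigma (adj k) (\<lambda>a. adj k - {a}))"
    unfolding W_def adj_def by auto
  have vertex: "6 * \<rho> * card (adj k) \<le> 12 * \<rho>\<^sup>2 * of_bool (k \<in> ?N) + card (adj k) * (card (adj k) - 1)"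
    if k: "k \<in> W" for k
  proof (cases "adj k = {}")
    case False
    then have "k \<in> ?N" using k by (auto simp: adj_def good_def W_def)
    then show ?thesis using degree_inequality[OF assms(3), of "card (adj k)"] by simp
  qed simp
  have N: "card ?N = (\<Sum>k\<in>W. of_bool (k \<in> ?N))"
  proof -
    have "?N = W \<inter> {k. k \<in> ?N}" by (auto simp: W_def)
    then show ?thesis using fin(1) by (simp add: of_bool_def sum.If_cases)
  qed
  have "card ?C = (\<Sum>k\<in>W. card (adj k) * (card (adj k) - 1))"
    unfolding C using fin by (simp add: card_Diff_singleton_if)
  moreover have "card ?G = (\<Sum>k\<in>W. card (adj k))"
    unfolding G using fin by simp
  moreover have "(\<Sum>k\<in>W. 6 * \<rho> * card (adj k))
      \<le> (\<Sum>k\<in>W. 12 * \<rho>\<^sup>2 * of_bool (k \<in> ?N) + card (adj k) * (card (adj k) - 1))"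
    by (rule sum_mono[OF vertex])
  ultimately show ?thesis
    unfolding N by (simp only: sum.distrib sum_distrib_left)
qed

text \<open>The local inequalities are summed over R and moved to P, which produces the common
  factor \<rho>^3. The coefficient 32 is 12 from the vertices, 6 * 2 from the full pairs that are
  not good, and 8 from the cherries; the cherries alone give the 8 for crowded elements.\<close>

lemma weighted_full_pairs:
  fixes \<rho> :: nat
  assumes "finite V" "\<rho> \<ge> 1"
  defines "ws \<equiv> \<lambda>\<phi>. \<Sum>P\<in>Pow V. \<rho> ^ (card V - card P) * \<phi> P"
  shows "6 * ws (\<lambda>P. card (full_pairs P))
    \<le> 32 * ws (\<lambda>P. card (inactive P)) + 8 * ws (\<lambda>P. card (crowded P))"
proof -
  let ?U2 = "{(x, y). x \<in> V \<and> y \<in> V \<and> x \<noteq> y}"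
  let ?U3 = "{(k, a, b). k \<in> V \<and> a \<in> V \<and> b \<in> V \<and> k \<noteq> a \<and> k \<noteq> b \<and> a \<noteq> b}"
  have finU: "finite ?U2" "finite ?U3"
    by (rule finite_subset[of _ "V \<times> V"], auto simp: assms(1),
        rule finite_subset[of _ "V \<times> V \<times> V"], auto simp: assms(1))
  define G where "G R = {t \<in> ?U2. {fst t, snd t} \<inter> R = {} \<and> good R (fst t) (snd t)}" for R
  define N where "N R = {k \<in> V. {k} \<inter> R = {} \<and> k \<in> inactive (insert k R)}" for R
  define C where "C R = {t \<in> ?U3. {fst t, fst (snd t), snd (snd t)} \<inter> R = {} \<and>
    (good R (fst t) (fst (snd t)) \<and> good R (fst t) (snd (snd t)))}" for R
  have wsN: "ws (\<lambda>R. card (N R)) = \<rho> * ws (\<lambda>P. card (inactive P))"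
  proof -
    have "ws (\<lambda>R. card (N R)) = \<rho> ^ 1 * ws (\<lambda>P. card {k \<in> V. {k} \<subseteq> P \<and> k \<in> inactive (insert k (P - {k}))})"
      unfolding ws_def N_def by (rule weighted_shift) (use assms(1) in auto)
    also have "ws (\<lambda>P. card {k \<in> V. {k} \<subseteq> P \<and> k \<in> inactive (insert k (P - {k}))}) = ws (\<lambda>P. card (inactive P))"
      unfolding ws_def
    proof (intro sum.cong refl arg_cong2[of _ _ _ _ "(*)"] arg_cong[of _ _ card])
      fix P assume "P \<in> Pow V"
      then show "{k \<in> V. {k} \<subseteq> P \<and> k \<in> inactive (insert k (P - {k}))} = inactive P"
        by (auto simp: insert_absorb inactive_def)
    qed
    finally show ?thesis by simp
  qed
  have wsG: "\<rho>\<^sup>2 * ws (\<lambda>P. card (full_pairs P)) \<le> ws (\<lambda>R. card (G R)) + \<rho>\<^sup>2 * (2 * ws (\<lambda>P. card (inactive P)))"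
  proof -
    define G' where "G' P = {t \<in> ?U2. {fst t, snd t} \<subseteq> P \<and> good (P - {fst t, snd t}) (fst t) (snd t)}" for P
    have "ws (\<lambda>R. card (G R)) = \<rho>\<^sup>2 * ws (\<lambda>P. card (G' P))"
      unfolding ws_def G_def G'_def by (rule weighted_shift) (use assms(1) finU in auto)
    moreover have "ws (\<lambda>P. card (full_pairs P)) \<le> ws (\<lambda>P. card (G' P) + 2 * card (inactive P))"
      unfolding ws_def
    proof (intro sum_mono mult_left_mono)
      fix P assume P: "P \<in> Pow V"
      then have finP: "finite P" using assms(1) finite_subset by auto
      define B where "B = {(x, y). full P x y \<and> \<not> good (P - {x, y}) x y}"
      have finB: "finite B"
        by (rule finite_subset[OF _ finite_full_pairs[OF finP]]) (auto simp: B_def full_pairs_def)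
      have "full_pairs P \<subseteq> G' P \<union> B"
      proof
        fix t assume "t \<in> full_pairs P"
        then obtain x y where t: "t = (x, y)" "full P x y" by (auto simp: full_pairs_def)
        then show "t \<in> G' P \<union> B"
          using full_in[OF t(2)] P by (auto simp: G'_def B_def)
      qed
      moreover have "finite (G' P)" using finU(1) by (simp add: G'_def)
      ultimately have "card (full_pairs P) \<le> card (G' P \<union> B)" using finB by (intro card_mono) auto
      also have "\<dots> \<le> card (G' P) + card B" by (rule card_Un_le)
      also have "card B \<le> 2 * card (inactive P)" unfolding B_def by (rule card_bad_pairs[OF finP])
      finally show "card (full_pairs P) \<le> card (G' P) + 2 * card (inactive P)" by simp
    qed simp
    then have "\<rho>\<^sup>2 * ws (\<lambda>P. card (full_pairs P)) \<le> \<rho>\<^sup>2 * ws (\<lambda>P. card (G' P) + 2 * card (inactive P))"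
      by (rule mult_left_mono) simp
    moreover have "ws (\<lambda>P. card (G' P) + 2 * card (inactive P)) = ws (\<lambda>P. card (G' P)) + 2 * ws (\<lambda>P. card (inactive P))"
      unfolding ws_def by (simp add: sum.distrib sum_distrib_left algebra_simps)
    ultimately show ?thesis by (simp add: distrib_left)
  qed
  have wsC: "ws (\<lambda>R. card (C R)) \<le> \<rho> ^ 3 * (8 * (ws (\<lambda>P. card (inactive P)) + ws (\<lambda>P. card (crowded P))))"
  proof -
    define C' where "C' P = {t \<in> ?U3. {fst t, fst (snd t), snd (snd t)} \<subseteq> P \<and>
      (good (P - {fst t, fst (snd t), snd (snd t)}) (fst t) (fst (snd t)) \<and>
       good (P - {fst t, fst (snd t), snd (snd t)}) (fst t) (snd (snd t)))}" for P
    have "ws (\<lambda>R. card (C R)) = \<rho> ^ 3 * ws (\<lambda>P. card (C' P))"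
      unfolding ws_def C_def C'_def by (rule weighted_shift) (use assms(1) finU in auto)
    moreover have "ws (\<lambda>P. card (C' P)) \<le> ws (\<lambda>P. 8 * (card (inactive P) + card (crowded P)))"
      unfolding ws_def
    proof (intro sum_mono mult_left_mono)
      fix P assume "P \<in> Pow V"
      then have finP: "finite P" using assms(1) finite_subset by auto
      have "C' P \<subseteq> {(k, a, b). cherry P k a b}"
        using good_cherry by (auto simp: C'_def)
      moreover have "finite {(k, a, b). cherry P k a b}"
        by (rule finite_subset[of _ "P \<times> P \<times> P"]) (use cherry_in finP in auto)
      ultimately show "card (C' P) \<le> 8 * (card (inactive P) + card (crowded P))"
        using card_cherries[OF finP] card_mono le_trans by blast
    qed simp
    then have "\<rho> ^ 3 * ws (\<lambda>P. card (C' P)) \<le> \<rho> ^ 3 * ws (\<lambda>P. 8 * (card (inactive P) + card (crowded P)))"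
      by (rule mult_left_mono) simp
    moreover have "ws (\<lambda>P. 8 * (card (inactive P) + card (crowded P)))
        = 8 * (ws (\<lambda>P. card (inactive P)) + ws (\<lambda>P. card (crowded P)))"
      unfolding ws_def by (simp add: sum.distrib sum_distrib_left algebra_simps)
    ultimately show ?thesis by simp
  qed
  have "ws (\<lambda>R. 6 * \<rho> * card (G R)) \<le> ws (\<lambda>R. 12 * \<rho>\<^sup>2 * card (N R) + card (C R))"
    unfolding ws_def G_def N_def C_def
    by (intro sum_mono mult_left_mono local_inequality) (use assms in auto)
  moreover have "ws (\<lambda>R. 6 * \<rho> * card (G R)) = 6 * \<rho> * ws (\<lambda>R. card (G R))"
    "ws (\<lambda>R. 12 * \<rho>\<^sup>2 * card (N R) + card (C R)) = 12 * \<rho>\<^sup>2 * ws (\<lambda>R. card (N R)) + ws (\<lambda>R. card (C R))"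
    unfolding ws_def by (simp_all add: sum.distrib sum_distrib_left algebra_simps)
  ultimately have main: "6 * \<rho> * ws (\<lambda>R. card (G R)) \<le> 12 * \<rho>\<^sup>2 * ws (\<lambda>R. card (N R)) + ws (\<lambda>R. card (C R))"
    by simp
  define f i c where "f = ws (\<lambda>P. card (full_pairs P))" and "i = ws (\<lambda>P. card (inactive P))"
    and "c = ws (\<lambda>P. card (crowded P))"
  have "\<rho> ^ 3 * (6 * f) = 6 * \<rho> * (\<rho>\<^sup>2 * f)" by (simp add: power2_eq_square power3_eq_cube)
  also have "\<dots> \<le> 6 * \<rho> * (ws (\<lambda>R. card (G R)) + \<rho>\<^sup>2 * (2 * i))"
    using wsG unfolding f_def i_def by (rule mult_left_mono) simp
  also have "\<dots> = 6 * \<rho> * ws (\<lambda>R. card (G R)) + 6 * \<rho> * (\<rho>\<^sup>2 * (2 * i))"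
    by (rule distrib_left)
  also have "\<dots> \<le> 12 * \<rho>\<^sup>2 * (\<rho> * i) + \<rho> ^ 3 * (8 * (i + c)) + 6 * \<rho> * (\<rho>\<^sup>2 * (2 * i))"
    using main[unfolded wsN] wsC unfolding i_def c_def by (intro add_right_mono) (rule le_trans, auto)
  also have "\<dots> = \<rho> ^ 3 * (32 * i + 8 * c)"
    by (simp add: power2_eq_square power3_eq_cube algebra_simps)
  finally have "6 * f \<le> 32 * i + 8 * c" using assms(2) by simp
  then show ?thesis unfolding f_def i_def c_def .
qed

lemma weighted_bound:
  fixes \<rho> :: nat
  assumes "finite V" "\<rho> \<ge> 1"
  shows "real (\<Sum>P\<in>Pow V. \<rho> ^ (card V - card P) * card (F P))
    \<le> (1 + real \<rho>) ^ card V + (1 + 83 / 192) * real (card V) * (1 + real \<rho>) ^ (card V - 1)"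
proof -
  define ws where "ws = (\<lambda>\<phi>. \<Sum>P\<in>Pow V. \<rho> ^ (card V - card P) * (\<phi> P :: nat))"
  have add: "ws (\<lambda>P. \<phi> P + \<psi> P) = ws \<phi> + ws \<psi>" and mult: "ws (\<lambda>P. c * \<phi> P) = c * ws \<phi>" for \<phi> \<psi> c
    unfolding ws_def by (simp_all add: sum.distrib sum_distrib_left algebra_simps)
  have mono: "ws \<phi> \<le> ws \<psi>" if "\<And>P. finite P \<Longrightarrow> \<phi> P \<le> \<psi> P" for \<phi> \<psi>
    unfolding ws_def
    by (intro sum_mono mult_left_mono that) (use assms(1) finite_subset in auto)
  define n f s i p q c where "n = ws (\<lambda>P. 1)" and "f = ws (\<lambda>P. card (F P))" and "s = ws card"
    and "i = ws (\<lambda>P. card (inactive P))" and "p = ws (\<lambda>P. card (paired P))"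
    and "q = ws (\<lambda>P. card (full_pairs P))" and "c = ws (\<lambda>P. card (crowded P))"
  note defs = n_def f_def s_def i_def p_def q_def c_def
  have 1: "12 * f \<le> 12 * n + 12 * s + 3 * p + 3 * q + 4 * c"
  proof -
    have "ws (\<lambda>P. 12 * card (F P)) \<le> ws (\<lambda>P. 12 * 1 + 12 * card P + 3 * card (paired P)
        + 3 * card (full_pairs P) + 4 * card (crowded P))"
      by (rule mono) (use card_F_bound in simp)
    then show ?thesis unfolding defs add mult .
  qed
  have 2: "q \<le> p" unfolding defs by (rule mono[OF full_pairs_le_paired])
  have 3: "s \<le> i + p + c"
  proof -
    have "ws card \<le> ws (\<lambda>P. card (inactive P) + card (paired P) + card (crowded P))"
      by (rule mono) (simp add: card_partition)
    then show ?thesis unfolding defs add .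
  qed
  have 5: "i + p + c \<le> s"
  proof -
    have "ws (\<lambda>P. card (inactive P) + card (paired P) + card (crowded P)) \<le> ws card"
      by (rule mono) (simp add: card_partition)
    then show ?thesis unfolding defs add .
  qed
  have 4: "6 * q \<le> 32 * i + 8 * c"
    unfolding defs ws_def by (rule weighted_full_pairs[OF assms])
  \<comment> \<open>After multiplying \<open>1\<close> by 16, it remains to see 48 q <= 83 i + 35 p
    + 19 c. Split 48 q into 35 q <= 35 p and 13 q <= (13/6) (32 i + 8 c). There is room: splitting
    21 q as 15 q + 6 q in the same way would give 3/7 in place of 83/192.\<close>
  have "192 * f \<le> 192 * n + 275 * s"
    using 1 2 3 4 5 by linarith
  then have "real (192 * f) \<le> real (192 * n + 275 * s)"
    by (simp only: of_nat_le_iff)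
  then have bound: "real f \<le> real n + (1 + 83 / 192) * real s"
    by simp
  have n: "real n = (1 + real \<rho>) ^ card V"
    using sum_weights[OF assms(1), of \<rho>] by (simp add: n_def ws_def)
  have s: "real s = real (card V) * (1 + real \<rho>) ^ (card V - 1)"
  proof (cases "card V")
    case 0
    then have "V = {}" using assms(1) by simp
    then show ?thesis by (simp add: s_def ws_def)
  next
    case (Suc k)
    have "(1 + \<rho>) * s = card V * (1 + \<rho>) ^ card V"
      unfolding s_def ws_def by (rule sum_weighted_card[OF assms(1)])
    also have "\<dots> = (1 + \<rho>) * (card V * (1 + \<rho>) ^ k)"
      by (simp add: Suc algebra_simps)
    finally have "s = card V * (1 + \<rho>) ^ k" by (subst (asm) mult_cancel1) simp
    then show ?thesis using Suc by (simp add: algebra_simps)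
  qed
  show ?thesis using bound n s by (simp add: f_def ws_def)
qed

end

subsection \<open>Matrices\<close>

lemma ex_permutation_between:
  fixes n :: nat
  assumes "inj_on f {0..<n}" "inj_on g {0..<n}" "f ` {0..<n} = g ` {0..<n}"
  obtains p where "p permutes {0..<n}" "\<And>a. a < n \<Longrightarrow> f a = g (p a)"
proof -
  define p where "p a = (if a < n then inv_into {0..<n} g (f a) else a)" for a
  have p: "p a \<in> {0..<n} \<and> g (p a) = f a" if "a < n" for a
  proof -
    have "f a \<in> f ` {0..<n}" using that by simp
    then have "f a \<in> g ` {0..<n}" unfolding assms(3) .
    from inv_into_into[OF this] f_inv_into_f[OF this] show ?thesis
      using that by (simp add: p_def)
  qed
  have "inj_on p {0..<n}"
    using p assms(1) by (intro inj_onI) (metis atLeastLessThan_iff inj_onD)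
  moreover have "p ` {0..<n} \<subseteq> {0..<n}" using p by auto
  ultimately have "bij_betw p {0..<n} {0..<n}"
    by (simp add: bij_betw_def endo_inj_surj)
  then have "p permutes {0..<n}" by (rule bij_imp_permutes) (simp add: p_def)
  then show thesis using that p by metis
qed

lemma pick_bij:
  assumes "finite I"
  shows "inj_on (pick I) {0..<card I}" "pick I ` {0..<card I} = I"
proof -
  show inj: "inj_on (pick I) {0..<card I}"
    by (intro linorder_inj_onI) (auto dest: pick_mono_le)
  show "pick I ` {0..<card I} = I"
    using assms inj by (intro card_subset_eq) (auto simp: card_image pick_in_set_le)
qed

text \<open>A submatrix lists the chosen rows and columns in increasing order through
  \<open>pick\<close>, while f and g list them in the order of F; the permutations p and q translate
  between the two.\<close>

lemma contains_configurationI: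
  assumes f: "inj_on f {0..<dim_row F}" "f ` {0..<dim_row F} \<subseteq> {0..<dim_row A}"
    and g: "inj_on g {0..<dim_col F}" "g ` {0..<dim_col F} \<subseteq> {0..<dim_col A}"
    and eq: "\<And>a b. a < dim_row F \<Longrightarrow> b < dim_col F \<Longrightarrow> A $$ (f a, g b) = F $$ (a, b)"
  shows "contains_configuration A F"
proof -
  define I J where "I = f ` {0..<dim_row F}" and "J = g ` {0..<dim_col F}"
  have card: "card I = dim_row F" "card J = dim_col F"
    using f g by (simp_all add: I_def J_def card_image)
  have "{i. i < dim_row A \<and> i \<in> I} = I" "{j. j < dim_col A \<and> j \<in> J} = J"
    using f(2) g(2) by (auto simp: I_def J_def)
  then have dims: "card {i. i < dim_row A \<and> i \<in> I} = dim_row F" "card {j. j < dim_col A \<and> j \<in> J} = dim_col F"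
    using card by simp_all
  have fin: "finite I" "finite J" by (simp_all add: I_def J_def)
  obtain p where p: "p permutes {0..<dim_row F}" "\<And>a. a < dim_row F \<Longrightarrow> pick I a = f (p a)"
    by (rule ex_permutation_between[of "pick I" "dim_row F" f])
      (use pick_bij[OF fin(1)] f card in \<open>simp_all add: I_def\<close>)
  obtain q where q: "q permutes {0..<dim_col F}" "\<And>b. b < dim_col F \<Longrightarrow> pick J b = g (q b)"
    by (rule ex_permutation_between[of "pick J" "dim_col F" g])
      (use pick_bij[OF fin(2)] g card in \<open>simp_all add: J_def\<close>)
  have "submatrix A I J $$ (a, b) = F $$ (p a, q b)" if "a < dim_row F" "b < dim_col F" for a b
  proof -
    have "p a < dim_row F" "q b < dim_col F"
      using permutes_in_image[OF p(1), of a] permutes_in_image[OF q(1), of b] that by simp_all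
    then show ?thesis using that p(2) q(2) eq dims by (simp add: submatrix_index)
  qed
  then have "row_col_permutation (submatrix A I J) F"
    unfolding row_col_permutation_def using p(1) q(1) dims by (auto simp: dim_submatrix)
  then show ?thesis unfolding contains_configuration_def by blast
qed

lemma dim_M: "dim_row M = 3" "dim_col M = 2"
  by (simp_all add: M_def mat_of_rows_list_def)

lemma contains_M:
  fixes A :: "nat mat"
  assumes "i < dim_row A" "j < dim_row A" "l < dim_row A" "c < dim_col A" "d < dim_col A"
    and "i \<noteq> j"
    and "A $$ (i, c) = 0" "A $$ (j, c) = 0" "A $$ (l, c) = 1"
    and "A $$ (i, d) = 1" "A $$ (j, d) = 1" "A $$ (l, d) = 0"
  shows "contains_configuration A M"
proof (rule contains_configurationI)
  have ne: "i \<noteq> l" "j \<noteq> l" "c \<noteq> d" using assms by auto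
  let ?f = "\<lambda>a. [i, j, l] ! a" and ?g = "\<lambda>b. [c, d] ! b"
  have three: "{0..<3} = {0, 1, 2 :: nat}" and two: "{0..<2} = {0, 1 :: nat}" by auto
  show "inj_on ?f {0..<dim_row M}" "?f ` {0..<dim_row M} \<subseteq> {0..<dim_row A}"
    using assms ne by (auto simp: dim_M three)
  show "inj_on ?g {0..<dim_col M}" "?g ` {0..<dim_col M} \<subseteq> {0..<dim_col A}"
    using assms ne by (auto simp: dim_M two)
  fix a b assume "a < dim_row M" "b < dim_col M"
  then have "a \<in> {0, 1, 2}" "b \<in> {0, 1}" by (auto simp: dim_M)
  then show "A $$ (?f a, ?g b) = M $$ (a, b)"
    using assms by (auto simp: M_def mat_of_rows_list_def)
qed

section \<open>Columns coded by sets, and averaging over sigma\<close>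

definition column_of :: "nat \<Rightarrow> (nat \<Rightarrow> nat) \<Rightarrow> nat set \<Rightarrow> nat set \<Rightarrow> nat vec" where
  "column_of m \<sigma> S X = vec m (\<lambda>i. if i \<in> X then 1 else if i \<in> S then 0 else \<sigma> i)"

text \<open>The family is empty unless S consists of row indices, so that the conditions of
  \<open>conflict_free\<close>, which range over all sets S, only meet actual rows.\<close>

definition column_family :: "nat mat \<Rightarrow> (nat \<Rightarrow> nat) \<Rightarrow> nat set \<Rightarrow> nat set set" where
  "column_family A \<sigma> S =
     {X. X \<subseteq> S \<and> S \<subseteq> {0..<dim_row A} \<and> column_of (dim_row A) \<sigma> S X \<in> set (cols A)}"

lemma column_familyE:
  assumes "X \<in> column_family A \<sigma> S"
  obtains c where "c < dim_col A" "X \<subseteq> S" "S \<subseteq> {0..<dim_row A}"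
    "\<And>i. i < dim_row A \<Longrightarrow> A $$ (i, c) = (if i \<in> X then 1 else if i \<in> S then 0 else \<sigma> i)"
proof -
  obtain c where c: "c < dim_col A" "column_of (dim_row A) \<sigma> S X = col A c"
    using assms by (auto simp: column_family_def cols_def)
  have "A $$ (i, c) = (if i \<in> X then 1 else if i \<in> S then 0 else \<sigma> i)" if "i < dim_row A" for i
  proof -
    have "A $$ (i, c) = column_of (dim_row A) \<sigma> S X $ i" using that c by simp
    then show ?thesis using that by (simp add: column_of_def)
  qed
  then show thesis by (rule that[OF c(1), rotated 2]) (use assms in \<open>simp_all add: column_family_def\<close>)
qed

lemma conflict_free_column_family:
  assumes "\<not> contains_configuration A M"
  shows "conflict_free (column_family A \<sigma>)"
proof
  show "X \<subseteq> S" if "X \<in> column_family A \<sigma> S" for X S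
    using that by (simp add: column_family_def)
  show False if X: "X \<in> column_family A \<sigma> S" and Y: "Y \<in> column_family A \<sigma> T"
    and ij: "i \<in> X - Y" "j \<in> X - Y" "i \<noteq> j" and l: "l \<in> Y - X"
    and inT: "i \<in> T" "j \<in> T" and inS: "l \<in> S" for X Y S T i j l
  proof -
    obtain c where c: "c < dim_col A" "X \<subseteq> S" "S \<subseteq> {0..<dim_row A}"
      "\<And>i. i < dim_row A \<Longrightarrow> A $$ (i, c) = (if i \<in> X then 1 else if i \<in> S then 0 else \<sigma> i)"
      using X by (rule column_familyE) blast
    obtain d where d: "d < dim_col A" "Y \<subseteq> T" "T \<subseteq> {0..<dim_row A}"
      "\<And>i. i < dim_row A \<Longrightarrow> A $$ (i, d) = (if i \<in> Y then 1 else if i \<in> T then 0 else \<sigma> i)"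
      using Y by (rule column_familyE) blast
    have "i < dim_row A" "j < dim_row A" "l < dim_row A" using inT inS c(3) d(3) by auto
    \<comment> \<open>The first column of M is 0 on the two equal rows, which is the column d of Y;
      hence d comes before c.\<close>
    then have "contains_configuration A M"
      by (intro contains_M[of i A j l d c]) (use c d ij l inT inS in auto)
    then show False using assms by simp
  qed
qed

text \<open>The map is prescribed in the rows where c is at least 2 and takes any of r - 2 values in
  each of the others.\<close>

lemma card_extensions:
  fixes c :: "nat \<Rightarrow> nat"
  assumes "\<And>i. i < m \<Longrightarrow> c i < r" "r \<ge> 2"
  shows "card {\<sigma> \<in> {0..<m} \<rightarrow>\<^sub>E {2..<r}. \<forall>i<m. c i \<ge> 2 \<longrightarrow> \<sigma> i = c i}
    = (r - 2) ^ card {i \<in> {0..<m}. c i \<le> 1}"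
proof -
  have "{\<sigma> \<in> {0..<m} \<rightarrow>\<^sub>E {2..<r}. \<forall>i<m. c i \<ge> 2 \<longrightarrow> \<sigma> i = c i}
      = (\<Pi>\<^sub>E i\<in>{0..<m}. if c i \<le> 1 then {2..<r} else {c i})" (is "?L = ?R")
  proof (intro equalityI subsetI)
    fix \<sigma> assume "\<sigma> \<in> ?L"
    then show "\<sigma> \<in> ?R" by (auto simp: PiE_iff not_le numeral_2_eq_2)
  next
    fix \<sigma> assume R: "\<sigma> \<in> ?R"
    have "\<sigma> i \<in> {2..<r} \<and> (c i \<ge> 2 \<longrightarrow> \<sigma> i = c i)" if "i < m" for i
      using PiE_mem[OF R, of i] assms(1)[OF that] that by (auto split: if_splits)
    moreover have "\<sigma> \<in> extensional {0..<m}" using R by (simp add: PiE_iff)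
    ultimately show "\<sigma> \<in> ?L" by (auto simp: PiE_iff)
  qed
  also have "card \<dots> = (\<Prod>i\<in>{0..<m}. if c i \<le> 1 then r - 2 else 1)"
    by (subst card_PiE) (auto intro!: prod.cong)
  also have "\<dots> = (r - 2) ^ card {i \<in> {0..<m}. c i \<le> 1}"
    by (simp add: prod.If_cases Int_def)
  finally show ?thesis .
qed

text \<open>Pairs of a map \<sigma> and a column agreeing with it are counted with weight. A column
  with s entries at most 1 agrees with \<rho>^s maps and has weight \<rho>^(m - s) for each, so
  every column contributes \<rho>^m, which is also the number of maps. The bound for one \<sigma>
  therefore carries over to the number of columns.\<close>

lemma dim_col_bound:
  assumes A: "A \<in> avoiding_matrices m r M" and r: "r \<ge> 3"
  shows "real (dim_col A) \<le> (real r - 1) ^ m + (1 + 83 / 192) * real m * (real r - 1) ^ (m - 1)"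
    (is "_ \<le> ?bound")
proof -
  define \<rho> where "\<rho> = r - 2"
  define V where "V = {0..<m}"
  define w where "w S = \<rho> ^ (m - card S)" for S :: "nat set"
  define \<Sigma> where "\<Sigma> = V \<rightarrow>\<^sub>E {2..<r}"
  define C where "C = set (cols A)"
  define agree where "agree \<sigma> c \<longleftrightarrow> (\<forall>i<m. c $ i \<ge> 2 \<longrightarrow> \<sigma> i = c $ i)" for \<sigma> :: "nat \<Rightarrow> nat" and c :: "nat vec"
  define low where "low c = {i \<in> V. c $ i \<le> 1}" for c :: "nat vec"
  have dim: "dim_row A = m" and rm: "r_matrix r A" and simple: "distinct (cols A)"
    and avoid: "\<not> contains_configuration A M"
    using A by (auto simp: avoiding_matrices_def simple_mat_def)
  have finV: "finite V" "card V = m" by (simp_all add: V_def)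
  have fin\<Sigma>: "finite \<Sigma>" unfolding \<Sigma>_def by (intro finite_PiE finV(1)) simp
  have card\<Sigma>: "card \<Sigma> = \<rho> ^ m"
    unfolding \<Sigma>_def \<rho>_def using finV by (simp add: card_PiE)
  have C: "dim_vec c = m" "\<And>i. i < m \<Longrightarrow> c $ i < r" if c: "c \<in> C" for c
  proof -
    obtain j where j: "j < dim_col A" "c = col A j" using c by (auto simp: C_def cols_def)
    then show "dim_vec c = m" using dim by simp
    fix i assume i: "i < m"
    have "A $$ (i, j) \<in> elements_mat A"
      by (rule elements_matI[of A m "dim_col A" i j]) (use i j dim in auto)
    then show "c $ i < r" using rm i j dim by (auto simp: r_matrix_def)
  qed
  have upper: "real (\<Sum>S\<in>Pow V. w S * card (column_family A \<sigma> S)) \<le> ?bound" for \<sigma>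
  proof -
    interpret conflict_free "column_family A \<sigma>" by (rule conflict_free_column_family[OF avoid])
    have "1 + real \<rho> = real r - 1" using r by (simp add: \<rho>_def)
    then show ?thesis
      using weighted_bound[OF finV(1), of \<rho>] r finV(2) by (simp add: w_def \<rho>_def)
  qed
  \<comment> \<open>A column agreeing with \<sigma> is recovered from its rows with entry at most 1
    and, among them, the rows with entry 1.\<close>
  have lower: "(\<Sum>c\<in>{c \<in> C. agree \<sigma> c}. w (low c)) \<le> (\<Sum>S\<in>Pow V. w S * card (column_family A \<sigma> S))" for \<sigma>
  proof -
    have finF: "finite (column_family A \<sigma> S)" if "S \<in> Pow V" for S
      by (rule finite_subset[of _ "Pow S"]) (use that finV in \<open>auto simp: column_family_def finite_subset\<close>)
    have "(\<Sum>c\<in>{c \<in> C. agree \<sigma> c}. w (low c))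
        \<le> (\<Sum>t\<in>Sigma (Pow V) (column_family A \<sigma>). w (fst t))"
    proof (rule sum_le_included[where i = "\<lambda>t. column_of m \<sigma> (fst t) (snd t)"])
      show "finite {c \<in> C. agree \<sigma> c}" by (simp add: C_def)
      show "finite (Sigma (Pow V) (column_family A \<sigma>))" using finV finF by (intro finite_SigmaI) auto
      show "\<forall>c\<in>{c \<in> C. agree \<sigma> c}. \<exists>t\<in>Sigma (Pow V) (column_family A \<sigma>).
          column_of m \<sigma> (fst t) (snd t) = c \<and> w (low c) \<le> w (fst t)"
      proof
        fix c assume c: "c \<in> {c \<in> C. agree \<sigma> c}"
        define X where "X = {i \<in> V. c $ i = 1}"
        have eq: "column_of m \<sigma> (low c) X = c"
        proof (rule eq_vecI)
          show "dim_vec (column_of m \<sigma> (low c) X) = dim_vec c" using C c by (simp add: column_of_def)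
          fix i assume "i < dim_vec c"
          then have "i < m" using C c by simp
          moreover consider "c $ i = 0" | "c $ i = 1" | "c $ i \<ge> 2" by linarith
          ultimately show "column_of m \<sigma> (low c) X $ i = c $ i"
            using c by cases (auto simp: column_of_def low_def X_def V_def agree_def)
        qed
        then have "X \<in> column_family A \<sigma> (low c)"
          using c dim by (auto simp: column_family_def X_def low_def V_def C_def)
        then show "\<exists>t\<in>Sigma (Pow V) (column_family A \<sigma>).
          column_of m \<sigma> (fst t) (snd t) = c \<and> w (low c) \<le> w (fst t)"
          using eq by (intro bexI[of _ "(low c, X)"]) (auto simp: low_def)
      qed
    qed simp
    also have "\<dots> = (\<Sum>S\<in>Pow V. w S * card (column_family A \<sigma> S))"
    proof -
      have "(\<Sum>S\<in>Pow V. \<Sum>X\<in>column_family A \<sigma> S. w S) = (\<Sum>t\<in>Sigma (Pow V) (column_family A \<sigma>). w (fst t))"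
        using sum.Sigma[of "Pow V" "column_family A \<sigma>" "\<lambda>S _. w S"] finV finF
        by (simp add: split_def)
      then show ?thesis by (simp add: mult.commute)
    qed
    finally show ?thesis .
  qed
  have "(\<Sum>\<sigma>\<in>\<Sigma>. \<Sum>c\<in>{c \<in> C. agree \<sigma> c}. w (low c)) = (\<Sum>c\<in>C. \<Sum>\<sigma>\<in>{\<sigma> \<in> \<Sigma>. agree \<sigma> c}. w (low c))"
    by (rule sum.swap_restrict) (use fin\<Sigma> in \<open>simp_all add: C_def\<close>)
  also have "\<dots> = (\<Sum>c\<in>C. \<rho> ^ m)"
  proof (rule sum.cong[OF refl])
    fix c assume c: "c \<in> C"
    have "card {\<sigma> \<in> \<Sigma>. agree \<sigma> c} = \<rho> ^ card (low c)"
      unfolding \<Sigma>_def agree_def low_def V_def \<rho>_def by (rule card_extensions) (use C(2)[OF c] r in auto)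
    moreover have "card (low c) \<le> m"
      using card_mono[OF finV(1), of "low c"] finV(2) by (auto simp: low_def)
    ultimately show "(\<Sum>\<sigma>\<in>{\<sigma> \<in> \<Sigma>. agree \<sigma> c}. w (low c)) = \<rho> ^ m"
      by (simp add: w_def power_add[symmetric])
  qed
  also have "\<dots> = dim_col A * \<rho> ^ m"
    using distinct_card[OF simple] by (simp add: C_def)
  finally have "real (dim_col A * \<rho> ^ m) = (\<Sum>\<sigma>\<in>\<Sigma>. real (\<Sum>c\<in>{c \<in> C. agree \<sigma> c}. w (low c)))"
    by (metis of_nat_sum)
  also have "\<dots> \<le> (\<Sum>\<sigma>\<in>\<Sigma>. ?bound)"
    by (rule sum_mono) (rule order_trans[OF of_nat_mono[OF lower] upper])
  also have "\<dots> = ?bound * real (\<rho> ^ m)" using card\<Sigma> by simp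
  finally have "real (dim_col A) * real (\<rho> ^ m) \<le> ?bound * real (\<rho> ^ m)" by simp
  moreover have "real (\<rho> ^ m) > 0" using r by (simp add: \<rho>_def)
  ultimately show ?thesis by (rule mult_right_le_imp_le)
qed

theorem theorem1p7:
  fixes m r :: nat
  assumes "r \<ge> 3"
  shows "real (forb m r M) \<le>
    (1 + 83 / 192) * real m * (real r - 1) powi (int m - 1) + (real r - 1) ^ m"
proof -
  have "forb m r M \<in> dim_col ` avoiding_matrices m r M"
    unfolding forb_def
    by (intro Max_in finite_dim_col_avoiding avoiding_matrices_nonempty) (simp add: dim_M)
  then obtain A where A: "A \<in> avoiding_matrices m r M" "forb m r M = dim_col A" by auto
  \<comment> \<open>For m = 0 the exponents are -1 on the left and, by truncation, 0 on the right;
    the factor m makes both sides vanish.\<close>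
  have pow: "real m * (real r - 1) powi (int m - 1) = real m * (real r - 1) ^ (m - 1)"
  proof (cases m)
    case (Suc k)
    then have "int m - 1 = int k" by simp
    then show ?thesis using Suc by (simp only: power_int_of_nat) simp
  qed simp
  show ?thesis using dim_col_bound[OF A(1) assms] A(2) by (simp only: mult.assoc pow add.commute)
qed

end
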